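(* Let $\mathcal{E}:[0,T]\times X\to\mathbb{R}$ comply with $(\mathrm{E}_1)$, $(\mathrm{E}_2)$ and $(\mathrm{E}_3)$ (listed in the context). Let $(u_n^0)_n\subset X$ and $u_0\in X$ fulfill $$u_n^0\to u_0\quad\text{and}\quad \mathcal{E}(0,u_n^0)\to\mathcal{E}(0,u_0)\qquad\text{as } n\to\infty,$$ and suppose that $u_0$ is $\mathsf{d}$-stable at time $0$, i.e. $\mathcal{E}(0,u_0)\le \mathcal{E}(0,v)+\mathsf{d}(u_0,v)$ for all $v\in X$. Let $(\mu_n)_n\subset(0,\infty)$ be a sequence with $\mu_n\to0$ and, correspondingly, let $(u_n)_n\subset \mathrm{BV}([0,T];X)$ be a sequence such that $u_n$ is a $\mathrm{VE}_{\mu_n}$ (Visco-Energetic) solution to the rate-independent system $(X,\mathcal{E},\mathsf{d})$ with $u_n(0)=u_n^0$. Then there exist a subsequence $(u_{n_k})_k$ and a curve $u\in \mathrm{BV}([0,T];X)$ such that $u(0)=u_0$, $$u_{n_k}(t)\to u(t)\quad\text{and}\quad \mathcal{E}(t,u_{n_k}(t))\to\mathcal{E}(t,u(t))\qquad\text{for every } t\in[0,T],$$ and $u$ is an Energetic solution to $(X,\mathcal{E},\mathsf{d})$.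
   Context: Standing setting: $T>0$, $(X,\mathsf{d})$ is a complete metric space, $\mathcal{E}:[0,T]\times X\to\mathbb{R}$. Fix a reference point $x_o\in X$ and set $\mathcal{F}(t,u):=\mathcal{E}(t,u)+\mathsf{d}(x_o,u)$. Assumptions. - $(\mathrm{E}_1)$: for all $C\in\mathbb{R}$, with $S_C:=\{(t,u)\in[0,T]\times X:\mathcal{F}(t,u)\le C\}$, $\mathcal{E}$ is lower semicontinuous on $S_C$ and $S_C$ is compact in $[0,T]\times X$. - $(\mathrm{E}_2)$: there is a map $\mathcal{P}:[0,T]\times X\to\mathbb{R}$ such that for all $(t,u)\in[0,T]\times X$ $$\liminf_{s\uparrow t}\frac{\mathcal{E}(t,u)-\mathcal{E}(s,u)}{t-s}\ge\mathcal{P}(t,u)\ge\limsup_{s\downarrow t}\frac{\mathcal{E}(s,u)-\mathcal{E}(t,u)}{s-t}$$ (each inequality being required when the corresponding one-sided limit makes sense in $[0,T]$), and there is $C_P>0$ with $|\mathcal{P}(t,u)|\le C_P\mathcal{F}(t,u)$ for all $(t,u)$. - $(\mathrm{E}_3)$: if $(t_n,u_n)\to(t,u)$ in $[0,T]\times X$ and $\mathcal{E}(t_n,u_n)\to\mathcal{E}(t,u)$, then $\limsup_n\mathcal{P}(t_n,u_n)\le\mathcal{P}(t,u)$. Variation. For $E\subset\mathbb{R}$ and $u:E\to X$, $\mathrm{Var}_{\mathsf d}(u,E)$ is the pointwise total variation $\sup\sum_{j=1}^M\mathsf{d}(u(t_{j-1}),u(t_j))$ over all finite $t_0<\dots<t_M$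 in $E$, with $\mathrm{Var}_{\mathsf d}(u,\emptyset)=0$. $\mathrm{BV}([0,T];X)$ is the set of $u:[0,T]\to X$ with $\mathrm{Var}_{\mathsf d}(u,[0,T])<\infty$; such $u$ has left/right limits $u(t-),u(t+)$ everywhere (with $u(0-):=u(0)$, $u(T+):=u(T)$) and an at most countable jump (discontinuity) set $\mathrm{J}_u$. Augmented variation. Given a cost $\mathsf{e}:[0,T]\times X\times X\to[0,\infty]$ with $\mathsf{e}(t,\cdot,\cdot)\ge\mathsf{d}$, set $\Delta_{\mathsf e}(t,u_-,u_+):=\mathsf{e}(t,u_-,u_+)-\mathsf{d}(u_-,u_+)$ and, for $[t_0,t_1]\subset[0,T]$, $$\mathrm{Jmp}_{\Delta_{\mathsf e}}(u;[t_0,t_1]):=\Delta_{\mathsf e}(t_0,u(t_0),u(t_0+))+\Delta_{\mathsf e}(t_1,u(t_1-),u(t_1))+\sum_{t\in\mathrm{J}_u\cap(t_0,t_1)}\big(\Delta_{\mathsf e}(t,u(t-),u(t))+\Delta_{\mathsf e}(t,u(t),u(t+))\big),$$ $$\mathrm{Var}_{\mathsf d,\mathsf e}(u,[t_0,t_1]):=\mathrm{Var}_{\mathsf d}(u,[t_0,t_1])+\mathrm{Jmp}_{\Delta_{\mathsf e}}(u;[t_0,t_1]).$$ Visco-energetic cost (for a parameter $\mu>0$). Residual stability function: $\mathcal{R}^\mu(t,x):=\sup_{y\in X}\{\mathcal{E}(t,x)-\mathcal{E}(t,y)-\mathsf{d}(x,y)-\frac{\mu}{2}\mathsf{d}^2(x,y)\}$.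 For a nonempty compact $E\subset\mathbb{R}$ let $E^-=\inf E$, $E^+=\sup E$, and let $\mathfrak{h}(E)$ be the collection of connected components $I$ (open intervals $(I^-,I^+)$) of $[E^-,E^+]\setminus E$. For $\vartheta\in\mathrm{C}(E;X)$ and $t\in[0,T]$, $$\mathrm{Trc}_{\mathrm{VE}}(t,\vartheta,E):=\mathrm{Var}_{\mathsf d}(\vartheta,E)+\sum_{I\in\mathfrak{h}(E)}\frac{\mu}{2}\mathsf{d}^2(\vartheta(I^-),\vartheta(I^+))+\sum_{s\in E\setminus\{E^+\}}\mathcal{R}^\mu(t,\vartheta(s)),$$ where the last sum is the supremum of the sums over finite subsets of $E\setminus\{E^+\}$ (and is $0$ if $E\setminus\{E^+\}=\emptyset$). Then $$\mathsf{c}_\mu(t,u_-,u_+):=\inf\{\mathrm{Trc}_{\mathrm{VE}}(t,\vartheta,E): E\subset\mathbb{R}\text{ compact},\ \vartheta\in\mathrm{C}(E;X),\ \vartheta(E^-)=u_-,\ \vartheta(E^+)=u_+\}.$$ $\mathrm{VE}_\mu$ solution: $u\in\mathrm{BV}([0,T];X)$ such that (i) $\mathcal{E}(t,u(t))\le\mathcal{E}(t,v)+\mathsf{d}(u(t),v)+\frac{\mu}{2}\mathsf{d}^2(u(t),v)$ for all $v\in X$ and all $t\in[0,T]\setminus\mathrm{J}_u$; (ii) $\mathcal{E}(t,u(t))+\mathrm{Var}_{\mathsf d,\mathsf c_\mu}(u,[0,t])=\mathcal{E}(0,u(0))+\int_0^t\mathcal{P}(s,u(s))\,ds$ for all $t\in[0,T]$.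 Energetic solution: $u\in\mathrm{BV}([0,T];X)$ such that for every $t\in[0,T]$: (i) $\mathcal{E}(t,u(t))\le\mathcal{E}(t,v)+\mathsf{d}(u(t),v)$ for all $v\in X$; (ii) $\mathcal{E}(t,u(t))+\mathrm{Var}_{\mathsf d}(u,[0,t])=\mathcal{E}(0,u(0))+\int_0^t\mathcal{P}(s,u(s))\,ds$. *)

theory Defs
  imports "HOL-Analysis.Analysis"
begin

(* Curves [0,T] -> X and functionals on [0,T] x X are total functions on the real line; their values
   at times outside [0,T] play no role. The structure (X,d) is the metric of the type 'a. *)

definition lsc_on :: "'b::topological_space set \<Rightarrow> ('b \<Rightarrow> real) \<Rightarrow> bool" where
  "lsc_on S f \<longleftrightarrow> (\<forall>x\<in>S. \<forall>c < f x. \<forall>\<^sub>F y in at x within S. c < f y)"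

definition perturbed :: "(real \<Rightarrow> 'a \<Rightarrow> real) \<Rightarrow> 'a \<Rightarrow> real \<Rightarrow> 'a::metric_space \<Rightarrow> real" where
  "perturbed E xo t u = E t u + dist xo u"

definition perturbed_sublevel ::
    "real \<Rightarrow> (real \<Rightarrow> 'a \<Rightarrow> real) \<Rightarrow> 'a::metric_space \<Rightarrow> real \<Rightarrow> (real \<times> 'a) set" where
  "perturbed_sublevel T E xo C = {(t, u). t \<in> {0..T} \<and> perturbed E xo t u \<le> C}"

definition cond_E1 :: "real \<Rightarrow> (real \<Rightarrow> 'a \<Rightarrow> real) \<Rightarrow> 'a::metric_space \<Rightarrow> bool" where
  "cond_E1 T E xo \<longleftrightarrow> (\<forall>C.
     lsc_on (perturbed_sublevel T E xo C) (\<lambda>(t, u). E t u) \<and>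
     compact (perturbed_sublevel T E xo C))"

definition cond_E2 ::
    "real \<Rightarrow> (real \<Rightarrow> 'a \<Rightarrow> real) \<Rightarrow> (real \<Rightarrow> 'a \<Rightarrow> real) \<Rightarrow> 'a::metric_space \<Rightarrow> bool" where
  "cond_E2 T E P xo \<longleftrightarrow>
     (\<forall>t\<in>{0<..T}. \<forall>u.
        Liminf (at_left t) (\<lambda>s. ereal ((E t u - E s u) / (t - s))) \<ge> ereal (P t u)) \<and>
     (\<forall>t\<in>{0..<T}. \<forall>u.
        ereal (P t u) \<ge> Limsup (at_right t) (\<lambda>s. ereal ((E s u - E t u) / (s - t)))) \<and>
     (\<exists>CP>0. \<forall>t\<in>{0..T}. \<forall>u. \<bar>P t u\<bar> \<le> CP * perturbed E xo t u)"

definition cond_E3 ::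
    "real \<Rightarrow> (real \<Rightarrow> 'a \<Rightarrow> real) \<Rightarrow> (real \<Rightarrow> 'a::metric_space \<Rightarrow> real) \<Rightarrow> bool" where
  "cond_E3 T E P \<longleftrightarrow> (\<forall>tn un t u.
     (\<forall>n. tn n \<in> {0..T}) \<longrightarrow> t \<in> {0..T} \<longrightarrow> tn \<longlonglongrightarrow> t \<longrightarrow> un \<longlonglongrightarrow> u \<longrightarrow>
     (\<lambda>n. E (tn n) (un n)) \<longlonglongrightarrow> E t u \<longrightarrow>
     limsup (\<lambda>n. ereal (P (tn n) (un n))) \<le> ereal (P t u))"

definition Var :: "(real \<Rightarrow> 'a::metric_space) \<Rightarrow> real set \<Rightarrow> ennreal" where
  "Var u S = (SUP (M, \<tau>) \<in> {(M, \<tau>). strict_mono_on {..M::nat} \<tau> \<and> \<tau> ` {..M} \<subseteq> S}.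
                ennreal (\<Sum>j<M. dist (u (\<tau> j)) (u (\<tau> (Suc j)))))"

definition BV :: "real \<Rightarrow> (real \<Rightarrow> 'a::metric_space) \<Rightarrow> bool" where
  "BV T u \<longleftrightarrow> Var u {0..T} < \<infinity>"

definition left_lim :: "(real \<Rightarrow> 'a::metric_space) \<Rightarrow> real \<Rightarrow> 'a" where
  "left_lim u t = (if t \<le> 0 then u t else Lim (at_left t) u)"

definition right_lim :: "real \<Rightarrow> (real \<Rightarrow> 'a::metric_space) \<Rightarrow> real \<Rightarrow> 'a" where
  "right_lim T u t = (if t \<ge> T then u t else Lim (at_right t) u)"

definition jump_set :: "real \<Rightarrow> (real \<Rightarrow> 'a::metric_space) \<Rightarrow> real set" where
  "jump_set T u = {t \<in> {0..T}. \<not> continuous (at t within {0..T}) u}"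

(* Subtraction on ennreal is truncated at 0; this is harmless for costs with e \<ge> d. *)
definition Delta :: "(real \<Rightarrow> 'a \<Rightarrow> 'a \<Rightarrow> ennreal) \<Rightarrow> real \<Rightarrow> 'a::metric_space \<Rightarrow> 'a \<Rightarrow> ennreal" where
  "Delta e t x y = e t x y - ennreal (dist x y)"

(* The formula is meant for nondegenerate intervals t0 < t1. On a single point the augmented
   variation is 0, as additivity over adjacent intervals requires. In particular the energy balance
   of a visco-energetic solution is trivial at t = 0 and does not exclude a jump at the initial time. *)
definition Jmp ::
    "real \<Rightarrow> (real \<Rightarrow> 'a \<Rightarrow> 'a \<Rightarrow> ennreal) \<Rightarrow> (real \<Rightarrow> 'a::metric_space) \<Rightarrow> real \<Rightarrow> real \<Rightarrow> ennreal" where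
  "Jmp T e u t0 t1 = (if t0 < t1 then
       Delta e t0 (u t0) (right_lim T u t0) + Delta e t1 (left_lim u t1) (u t1) +
       (\<Sum>\<^sub>\<infinity>t \<in> jump_set T u \<inter> {t0<..<t1}.
          Delta e t (left_lim u t) (u t) + Delta e t (u t) (right_lim T u t))
     else 0)"

definition aug_Var ::
    "real \<Rightarrow> (real \<Rightarrow> 'a \<Rightarrow> 'a \<Rightarrow> ennreal) \<Rightarrow> (real \<Rightarrow> 'a::metric_space) \<Rightarrow> real \<Rightarrow> real \<Rightarrow> ennreal" where
  "aug_Var T e u t0 t1 = Var u {t0..t1} + Jmp T e u t0 t1"

definition residual :: "(real \<Rightarrow> 'a \<Rightarrow> real) \<Rightarrow> real \<Rightarrow> real \<Rightarrow> 'a::metric_space \<Rightarrow> ereal" where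
  "residual E \<mu> t x = (SUP y. ereal (E t x - E t y - dist x y - \<mu> / 2 * (dist x y)\<^sup>2))"

definition holes :: "real set \<Rightarrow> real set set" where
  "holes K = components ({Inf K..Sup K} - K)"

(* residual is nonnegative (take y = x), so e2ennreal does not truncate. *)
definition Trc_VE ::
    "(real \<Rightarrow> 'a \<Rightarrow> real) \<Rightarrow> real \<Rightarrow> real \<Rightarrow> (real \<Rightarrow> 'a::metric_space) \<Rightarrow> real set \<Rightarrow> ennreal" where
  "Trc_VE E \<mu> t \<theta> K =
     Var \<theta> K +
     (\<Sum>\<^sub>\<infinity>I \<in> holes K. ennreal (\<mu> / 2 * (dist (\<theta> (Inf I)) (\<theta> (Sup I)))\<^sup>2)) +
     (SUP F \<in> {F. finite F \<and> F \<subseteq> K - {Sup K}}. \<Sum>s\<in>F. e2ennreal (residual E \<mu> t (\<theta> s)))"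

definition VE_cost ::
    "(real \<Rightarrow> 'a \<Rightarrow> real) \<Rightarrow> real \<Rightarrow> real \<Rightarrow> 'a::metric_space \<Rightarrow> 'a \<Rightarrow> ennreal" where
  "VE_cost E \<mu> t x y =
     (INF (\<theta>, K) \<in> {(\<theta>, K). K \<noteq> {} \<and> compact K \<and> continuous_on K \<theta> \<and>
                            \<theta> (Inf K) = x \<and> \<theta> (Sup K) = y}.
        Trc_VE E \<mu> t \<theta> K)"

definition d_stable :: "(real \<Rightarrow> 'a \<Rightarrow> real) \<Rightarrow> real \<Rightarrow> 'a::metric_space \<Rightarrow> bool" where
  "d_stable E t x \<longleftrightarrow> (\<forall>v. E t x \<le> E t v + dist x v)"

(* In both notions of solution the integral of the power is a Lebesgue integral and integrability is
   part of its meaning; without it the library would assign the value 0 to the integral. The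
   variations are a priori extended-valued, so the balances are stated in ereal. *)
definition VE_solution ::
    "real \<Rightarrow> (real \<Rightarrow> 'a \<Rightarrow> real) \<Rightarrow> (real \<Rightarrow> 'a \<Rightarrow> real) \<Rightarrow> real \<Rightarrow>
     (real \<Rightarrow> 'a::metric_space) \<Rightarrow> bool" where
  "VE_solution T E P \<mu> u \<longleftrightarrow>
     BV T u \<and>
     (\<forall>t \<in> {0..T} - jump_set T u. \<forall>v.
        E t (u t) \<le> E t v + dist (u t) v + \<mu> / 2 * (dist (u t) v)\<^sup>2) \<and>
     set_integrable lebesgue {0..T} (\<lambda>s. P s (u s)) \<and>
     (\<forall>t \<in> {0..T}.
        ereal (E t (u t)) + enn2ereal (aug_Var T (VE_cost E \<mu>) u 0 t) =
        ereal (E 0 (u 0) + (LINT s:{0..t}|lebesgue. P s (u s))))"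

definition energetic_solution ::
    "real \<Rightarrow> (real \<Rightarrow> 'a \<Rightarrow> real) \<Rightarrow> (real \<Rightarrow> 'a \<Rightarrow> real) \<Rightarrow> (real \<Rightarrow> 'a::metric_space) \<Rightarrow> bool" where
  "energetic_solution T E P u \<longleftrightarrow>
     BV T u \<and>
     (\<forall>t \<in> {0..T}. d_stable E t (u t)) \<and>
     set_integrable lebesgue {0..T} (\<lambda>s. P s (u s)) \<and>
     (\<forall>t \<in> {0..T}.
        ereal (E t (u t)) + enn2ereal (Var u {0..t}) =
        ereal (E 0 (u 0) + (LINT s:{0..t}|lebesgue. P s (u s))))"

end

theory Submission
  imports Defs "HOL-Library.Diagonal_Subsequence"
begin

text \<open>
  Only the inequality between the variation of \<open>u\<^sub>n\<close> and its augmented variation enters; the jump costs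
  are never analysed. Gronwall and Helly give a pointwise limit \<open>u\<close>. Off the countable union of the jump
  sets, the \<open>\<mu>\<^sub>n\<close>-stability of \<open>u\<^sub>n\<close> passes to the limit, so \<open>u\<close> is stable there and the energies
  converge.

  Put \<open>e(t) = E(t, u(t)) + Var(u, [0,t])\<close> and \<open>p(t) = P(t, u(t))\<close>. Stability of \<open>u\<close> bounds the lower left
  Dini derivative of \<open>e\<close> below by \<open>p\<close>, and Fatou's lemma for the difference quotients of \<open>e\<close> then bounds
  \<open>e(t) - e(0)\<close> below. Fatou's lemma for the powers of \<open>u\<^sub>n\<close>, with the upper semicontinuity (E3),
  bounds it above. The two Fatou limits enclose \<open>p\<close> and their integrals agree, so they
  coincide almost everywhere: this yields the measurability of \<open>p\<close> and the energy balance at once.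
  Finally, the balance on \<open>[s,t]\<close> with \<open>s \<rightarrow> t\<close> along stable points transports stability to every
  \<open>t > 0\<close>; at \<open>t = 0\<close> it is the hypothesis on the initial datum.
\<close>

section \<open>Dini derivatives and Gronwall's inequality\<close>

text \<open>Concede a slope \<epsilon> and take the supremum of the times with
  \<open>f t \<le> f a + \<epsilon> * (t - a)\<close>: left lower semicontinuity puts it in this
  set, and the right Dini bound moves past it unless it equals \<open>b\<close>.\<close>

lemma right_dini_nonincreasing:
  fixes f :: "real \<Rightarrow> real"
  assumes "a \<le> b"
    and lsc: "\<And>t c. \<lbrakk>a < t; t \<le> b; c < f t\<rbrakk> \<Longrightarrow> \<forall>\<^sub>F s in at_left t. c < f s"
    and dini: "\<And>t \<epsilon>. \<lbrakk>a \<le> t; t < b; \<epsilon> > 0\<rbrakk> \<Longrightarrow> \<forall>\<^sub>F s in at_right t. f s \<le> f t + \<epsilon> * (s - t)"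
  shows "f b \<le> f a"
proof (rule field_le_epsilon)
  fix \<delta> :: real assume "\<delta> > 0"
  \<comment> \<open>The \<open>+ 1\<close> covers the case \<open>a = b\<close>.\<close>
  define \<epsilon> where "\<epsilon> = \<delta> / (b - a + 1)"
  have \<epsilon>: "\<epsilon> > 0" "\<epsilon> * (b - a) \<le> \<delta>"
    using \<open>\<delta> > 0\<close> \<open>a \<le> b\<close> by (auto simp: \<epsilon>_def field_simps)
  define A where "A = {t \<in> {a..b}. f t \<le> f a + \<epsilon> * (t - a)}"
  define \<sigma> where "\<sigma> = Sup A"
  have "a \<in> A" using \<open>a \<le> b\<close> by (simp add: A_def)
  have bdd: "bdd_above A" unfolding A_def by (intro bdd_aboveI[of _ b]) auto
  have up: "s \<le> \<sigma>" if "s \<in> A" for s unfolding \<sigma>_def by (rule cSup_upper[OF that bdd])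
  have "\<sigma> \<le> b" unfolding \<sigma>_def using \<open>a \<in> A\<close> by (intro cSup_least) (auto simp: A_def)
  have "a \<le> \<sigma>" by (rule up[OF \<open>a \<in> A\<close>])
  have "\<sigma> \<in> A"
  proof (rule ccontr)
    assume n: "\<sigma> \<notin> A"
    then have gt: "f a + \<epsilon> * (\<sigma> - a) < f \<sigma>" using \<open>a \<le> \<sigma>\<close> \<open>\<sigma> \<le> b\<close> by (auto simp: A_def)
    have "a < \<sigma>" using n \<open>a \<in> A\<close> \<open>a \<le> \<sigma>\<close> by (cases "a = \<sigma>") auto
    from lsc[OF this \<open>\<sigma> \<le> b\<close> gt] obtain c where c: "c < \<sigma>" "\<And>y. c < y \<Longrightarrow> y < \<sigma> \<Longrightarrow> f a + \<epsilon> * (\<sigma> - a) < f y"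
      unfolding eventually_at_left_field by auto
    obtain s where s: "s \<in> A" "c < s" using less_cSupD[of A c] \<open>a \<in> A\<close> c(1) unfolding \<sigma>_def by auto
    have "s < \<sigma>" using up[OF s(1)] s(1) n by (cases "s = \<sigma>") auto
    have "f s \<le> f a + \<epsilon> * (s - a)" using s(1) by (simp add: A_def)
    also have "\<dots> \<le> f a + \<epsilon> * (\<sigma> - a)" using \<epsilon> \<open>s < \<sigma>\<close> by (simp add: mult_left_mono)
    finally show False using c(2)[OF s(2) \<open>s < \<sigma>\<close>] by simp
  qed
  moreover have "\<sigma> = b"
  proof (rule ccontr)
    assume "\<sigma> \<noteq> b"
    then have "\<sigma> < b" using \<open>\<sigma> \<le> b\<close> by simp
    from dini[OF \<open>a \<le> \<sigma>\<close> this \<epsilon>(1)] obtain c where c: "c > \<sigma>" "\<And>y. \<sigma> < y \<Longrightarrow> y < c \<Longrightarrow> f y \<le> f \<sigma> + \<epsilon> * (y - \<sigma>)"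
      unfolding eventually_at_right_field by auto
    define y where "y = (\<sigma> + min b c) / 2"
    have y: "\<sigma> < y" "y < c" "y < b" using c(1) \<open>\<sigma> < b\<close> by (auto simp: y_def min_def)
    have "f y \<le> f \<sigma> + \<epsilon> * (y - \<sigma>)" by (rule c(2)[OF y(1,2)])
    also have "\<dots> \<le> f a + \<epsilon> * (y - a)" using \<open>\<sigma> \<in> A\<close> by (simp add: A_def algebra_simps)
    finally have "y \<in> A" using y \<open>a \<le> \<sigma>\<close> by (simp add: A_def)
    then show False using up y(1) by force
  qed
  ultimately show "f b \<le> f a + \<delta>" using \<epsilon> by (auto simp: A_def)
qed

text \<open>The integrating factor \<open>exp (- (C * (t - a)))\<close> reduces the claim to
  monotonicity; \<open>1 + x \<le> exp x\<close> absorbs the term \<open>C * g t\<close>.\<close>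

lemma right_dini_gronwall:
  fixes g :: "real \<Rightarrow> real"
  assumes "a \<le> b" "C \<ge> 0"
    and nonneg: "\<And>t. \<lbrakk>a \<le> t; t \<le> b\<rbrakk> \<Longrightarrow> 0 \<le> g t"
    and lsc: "\<And>t c. \<lbrakk>a < t; t \<le> b; c < g t\<rbrakk> \<Longrightarrow> \<forall>\<^sub>F s in at_left t. c < g s"
    and dini: "\<And>t \<epsilon>. \<lbrakk>a \<le> t; t < b; \<epsilon> > 0\<rbrakk> \<Longrightarrow> \<forall>\<^sub>F s in at_right t. g s \<le> g t + (C * g t + \<epsilon>) * (s - t)"
  shows "g b \<le> exp (C * (b - a)) * g a"
proof -
  have less_exp_mult_iff: "c < exp (- x) * y \<longleftrightarrow> c * exp x < y" for c x y :: real
    by (simp add: exp_minus field_simps)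
  define f where "f t = exp (- (C * (t - a))) * g t" for t
  have "f b \<le> f a"
  proof (rule right_dini_nonincreasing[OF \<open>a \<le> b\<close>])
    fix t c assume t: "a < t" "t \<le> b" "c < f t"
    have "c * exp (C * (t - a)) < g t"
      using t(3) by (simp only: f_def less_exp_mult_iff)
    from lsc[OF t(1,2) this] show "\<forall>\<^sub>F s in at_left t. c < f s"
      using eventually_at_left_real[OF t(1)]
    proof eventually_elim
      case (elim s)
      have "c < exp (- (C * (t - a))) * g s"
        using elim(1) by (simp only: less_exp_mult_iff)
      \<comment> \<open>For \<open>s < t\<close> the weight at \<open>s\<close> is at least that at
        \<open>t\<close>, and \<open>g s\<close> is nonnegative, so the weight may be moved from
        \<open>t\<close> to \<open>s\<close>.\<close>
      also have "\<dots> \<le> f s" unfolding f_def using elim(2) t \<open>C \<ge> 0\<close>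
        by (intro mult_right_mono nonneg) (auto simp: mult_left_mono)
      finally show ?case .
    qed
  next
    fix t \<epsilon> :: real assume t: "a \<le> t" "t < b" "\<epsilon> > 0"
    from dini[OF this] show "\<forall>\<^sub>F s in at_right t. f s \<le> f t + \<epsilon> * (s - t)"
      using eventually_at_right_real[OF t(2)]
    proof eventually_elim
      case (elim s)
      have "exp (- (C * (s - a))) * (1 + C * (s - t)) \<le> exp (- (C * (s - a))) * exp (C * (s - t))"
        by (intro mult_left_mono) auto
      also have "\<dots> = exp (- (C * (t - a)))" by (simp add: algebra_simps flip: exp_add)
      finally have *: "exp (- (C * (s - a))) * (1 + C * (s - t)) * g t \<le> f t"
        unfolding f_def using nonneg t by (intro mult_right_mono) auto
      have "f s \<le> exp (- (C * (s - a))) * (g t + (C * g t + \<epsilon>) * (s - t))"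
        unfolding f_def using elim(1) by (intro mult_left_mono) auto
      also have "\<dots> = exp (- (C * (s - a))) * (1 + C * (s - t)) * g t + exp (- (C * (s - a))) * (\<epsilon> * (s - t))"
        by (simp add: algebra_simps)
      also have "\<dots> \<le> f t + 1 * (\<epsilon> * (s - t))"
        using elim t \<open>C \<ge> 0\<close> by (intro add_mono * mult_right_mono) auto
      finally show ?case by simp
    qed
  qed
  then show ?thesis using mult_left_mono[of "f b" "f a" "exp (C * (b - a))"]
    by (simp add: f_def flip: mult.assoc exp_add)
qed

section \<open>Variation and Helly's selection theorem\<close>

lemma Var_mono: "S \<subseteq> S' \<Longrightarrow> Var u S \<le> Var u S'"
  unfolding Var_def by (rule SUP_subset_mono) auto

lemma sum_dist_le_Var:
  "strict_mono_on {..M} \<tau> \<Longrightarrow> \<tau> ` {..M} \<subseteq> S \<Longrightarrow> ennreal (\<Sum>j<M. dist (u (\<tau> j)) (u (\<tau> (Suc j)))) \<le> Var u S"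
  unfolding Var_def by (rule SUP_upper2[of "(M, \<tau>)"]) auto

lemma strict_mono_on_extend:
  fixes \<tau> :: "nat \<Rightarrow> real"
  assumes "strict_mono_on {..M} \<tau>" "\<tau> M < x"
  shows "strict_mono_on {..Suc M} (\<tau>(Suc M := x))"
proof (rule strict_mono_onI)
  fix r s assume rs: "r \<in> {..Suc M}" "s \<in> {..Suc M}" "r < s"
  have "\<tau> r \<le> \<tau> M" if "r \<le> M"
    using strict_mono_onD[OF assms(1), of r M] that by (cases "r = M") auto
  then show "(\<tau>(Suc M := x)) r < (\<tau>(Suc M := x)) s"
    using rs assms(2) strict_mono_onD[OF assms(1), of r s] by (auto simp: le_Suc_eq)
qed

text \<open>Any partition of \<open>[a, s]\<close> can be made to end at \<open>s\<close> without
  decreasing its sum; appending \<open>t\<close> then adds the chord from \<open>u s\<close> to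
  \<open>u t\<close>.\<close>

lemma Var_add_dist_le:
  assumes "s \<le> t" "a \<le> s"
  shows "Var u {a..s} + ennreal (dist (u s) (u t)) \<le> Var u {a..t}"
proof (cases "s = t")
  case False
  let ?I = "{(M, \<tau>). strict_mono_on {..M::nat} \<tau> \<and> \<tau> ` {..M} \<subseteq> {a..s}}"
  have ne: "?I \<noteq> {}" using assms by (auto intro!: exI[of _ 0] exI[of _ "\<lambda>_. s"] simp: strict_mono_on_def)
  have "ennreal (\<Sum>j<M. dist (u (\<tau> j)) (u (\<tau> (Suc j)))) + ennreal (dist (u s) (u t)) \<le> Var u {a..t}"
    if \<tau>: "strict_mono_on {..M} \<tau>" "\<tau> ` {..M} \<subseteq> {a..s}" for M \<tau>
  \<comment> \<open>Nodes increase strictly, so \<open>s\<close> is inserted only when it is not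
    already the last one.\<close>
  proof (cases "\<tau> M = s")
    case True
    have "strict_mono_on {..Suc M} (\<tau>(Suc M := t))"
      using \<tau>(1) True \<open>s \<noteq> t\<close> assms by (intro strict_mono_on_extend) auto
    moreover have "\<tau>(Suc M := t) ` {..Suc M} \<subseteq> {a..t}"
      using \<tau>(2) assms by (fastforce simp: le_Suc_eq)
    ultimately have "ennreal (\<Sum>j<Suc M. dist (u ((\<tau>(Suc M := t)) j)) (u ((\<tau>(Suc M := t)) (Suc j)))) \<le> Var u {a..t}"
      by (rule sum_dist_le_Var)
    then show ?thesis using True by (simp add: sum_nonneg flip: ennreal_plus)
  next
    case False
    then have "\<tau> M < s" using \<tau>(2) by force
    let ?\<rho> = "\<tau>(Suc M := s, Suc (Suc M) := t)"
    have "strict_mono_on {..Suc (Suc M)} ?\<rho>"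
      using \<tau>(1) \<open>\<tau> M < s\<close> \<open>s \<noteq> t\<close> assms by (intro strict_mono_on_extend) auto
    moreover have "?\<rho> ` {..Suc (Suc M)} \<subseteq> {a..t}"
      using \<tau>(2) assms by (fastforce simp: le_Suc_eq)
    ultimately have "ennreal (\<Sum>j<Suc (Suc M). dist (u (?\<rho> j)) (u (?\<rho> (Suc j)))) \<le> Var u {a..t}"
      by (rule sum_dist_le_Var)
    moreover have "(\<Sum>j<Suc (Suc M). dist (u (?\<rho> j)) (u (?\<rho> (Suc j)))) \<ge>
      (\<Sum>j<M. dist (u (\<tau> j)) (u (\<tau> (Suc j)))) + dist (u s) (u t)" by simp
    ultimately show ?thesis
      by (simp add: sum_nonneg flip: ennreal_plus) (erule order_trans[OF ennreal_leI, rotated], simp)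
  qed
  then have "(SUP (M, \<tau>) \<in> ?I. ennreal (\<Sum>j<M. dist (u (\<tau> j)) (u (\<tau> (Suc j)))) + ennreal (dist (u s) (u t))) \<le> Var u {a..t}"
    by (intro SUP_least) auto
  then show ?thesis
    unfolding Var_def[of u "{a..s}"] ennreal_SUP_add_left[OF ne, symmetric] by (simp add: case_prod_unfold)
qed simp

lemma Var_singleton: "Var u {a} = 0"
proof -
  have "(\<Sum>j<M. dist (u (\<tau> j)) (u (\<tau> (Suc j)))) = 0" if \<tau>: "\<tau> ` {..M} \<subseteq> {a}" for M and \<tau> :: "nat \<Rightarrow> real"
  proof (intro sum.neutral ballI)
    fix j assume "j \<in> {..<M}"
    then have "\<tau> j \<in> {a}" "\<tau> (Suc j) \<in> {a}" by (intro subsetD[OF \<tau>] imageI; simp)+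
    then show "dist (u (\<tau> j)) (u (\<tau> (Suc j))) = 0" by simp
  qed
  then have "Var u {a} \<le> 0" unfolding Var_def by (intro SUP_least) auto
  then show ?thesis by simp
qed

text \<open>One partition witnesses \<open>c < Var u S\<close>, and its finite sum is continuous
  under pointwise convergence: lower semicontinuity of the variation.\<close>

lemma less_Var_eventually:
  assumes conv: "\<And>t. t \<in> S \<Longrightarrow> (\<lambda>n. v n t) \<longlonglongrightarrow> u t" and "c < Var u S"
  shows "\<forall>\<^sub>F n in sequentially. c < Var (v n) S"
proof -
  from assms(2) obtain M \<tau> where \<tau>: "strict_mono_on {..M} \<tau>" "\<tau> ` {..M} \<subseteq> S"
     "c < ennreal (\<Sum>j<M. dist (u (\<tau> j)) (u (\<tau> (Suc j))))"
    unfolding Var_def less_SUP_iff by auto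
  have "(\<lambda>n. ennreal (\<Sum>j<M. dist (v n (\<tau> j)) (v n (\<tau> (Suc j))))) \<longlonglongrightarrow> ennreal (\<Sum>j<M. dist (u (\<tau> j)) (u (\<tau> (Suc j))))"
    using \<tau>(2) by (intro tendsto_ennrealI tendsto_sum tendsto_dist conv) auto
  from order_tendstoD(1)[OF this \<tau>(3)] show ?thesis
    by eventually_elim (erule less_le_trans[OF _ sum_dist_le_Var[OF \<tau>(1,2)]])
qed

text \<open>A real-valued variation permits subtraction. Infinite variation is sent to 0, so the
  function is meaningful only for curves of bounded variation.\<close>

definition var_fun :: "(real \<Rightarrow> 'a::metric_space) \<Rightarrow> real \<Rightarrow> real" where
  "var_fun u t = enn2real (Var u {0..t})"

lemma Var_eq_var_fun:
  assumes "BV T u" "t \<le> T"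
  shows "Var u {0..t} = ennreal (var_fun u t)"
proof -
  have "Var u {0..t} \<le> Var u {0..T}" using assms by (intro Var_mono) auto
  then show ?thesis using assms(1) unfolding BV_def var_fun_def
    by (metis ennreal_enn2real infinity_ennreal_def order.strict_trans1)
qed

lemma var_fun_nonneg: "0 \<le> var_fun u t" by (simp add: var_fun_def)

text \<open>Finiteness allows the superadditivity of the variation to be rearranged; the curve is
  thereby controlled by the increments of a monotone real function.\<close>

lemma dist_le_var_fun_diff:
  assumes "BV T u" "0 \<le> s" "s \<le> t" "t \<le> T"
  shows "dist (u s) (u t) \<le> var_fun u t - var_fun u s"
proof -
  have "ennreal (var_fun u s) + ennreal (dist (u s) (u t)) \<le> ennreal (var_fun u t)"
    using Var_add_dist_le[OF assms(3,2), of u] Var_eq_var_fun[OF assms(1)] assms by simp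
  then show ?thesis
    by (simp add: var_fun_nonneg flip: ennreal_plus)
qed

lemma var_fun_mono:
  "BV T u \<Longrightarrow> 0 \<le> s \<Longrightarrow> s \<le> t \<Longrightarrow> t \<le> T \<Longrightarrow> var_fun u s \<le> var_fun u t"
  using order_trans[OF zero_le_dist dist_le_var_fun_diff[of T u s t]] by simp

text \<open>The curve is continuous wherever its variation function is, and a monotone function has
  at most countably many discontinuities.\<close>

lemma countable_jump_set:
  assumes "BV T u"
  shows "countable (jump_set T u)"
proof -
  have mono: "mono_on {0..T} (var_fun u)"
    by (intro mono_onI var_fun_mono[OF assms]) auto
  have "continuous (at t within {0..T}) u" if t: "t \<in> {0..T}" and "continuous (at t within {0..T}) (var_fun u)" for t
  proof -
    have "((\<lambda>s. dist (var_fun u s) (var_fun u t)) \<longlongrightarrow> 0) (at t within {0..T})"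
      using that(2) unfolding continuous_within by (subst (asm) tendsto_dist_iff)
    then have "((\<lambda>s. dist (u s) (u t)) \<longlongrightarrow> 0) (at t within {0..T})"
    proof (rule Lim_null_comparison[rotated])
      have "norm (dist (u s) (u t)) \<le> dist (var_fun u s) (var_fun u t)" if "s \<in> {0..T}" for s
        using dist_le_var_fun_diff[OF assms, of s t] dist_le_var_fun_diff[OF assms, of t s] that t
        by (cases "s \<le> t") (auto simp: dist_real_def dist_commute)
      then show "\<forall>\<^sub>F s in at t within {0..T}. norm (dist (u s) (u t)) \<le> dist (var_fun u s) (var_fun u t)"
        by (simp add: eventually_at_filter)
    qed
    then show ?thesis unfolding continuous_within by (subst tendsto_dist_iff)
  qed
  then have "jump_set T u \<subseteq> {t \<in> {0..T}. \<not> continuous (at t within {0..T}) (var_fun u)}"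
    unfolding jump_set_def by auto
  then show ?thesis using mono_on_ctble_discont[OF mono] by (rule countable_subset)
qed

section \<open>Selection of convergent subsequences\<close>

text \<open>Diagonal argument along an enumeration of \<open>D\<close>; compactness of
  \<open>K\<close> supplies the refinement at each point.\<close>

lemma pointwise_convergent_subseq:
  fixes f :: "nat \<Rightarrow> 'b \<Rightarrow> 'a::metric_space"
  assumes "countable D" "compact K" and K: "\<And>n x. x \<in> D \<Longrightarrow> f n x \<in> K"
  obtains r where "strict_mono r" "\<And>x. x \<in> D \<Longrightarrow> convergent (\<lambda>n. f (r n) x)"
proof (cases "D = {}")
  case True
  then show ?thesis using that[of id] by (simp add: strict_mono_id)
next
  case False
  define d where "d = from_nat_into D"
  have d: "d k \<in> D" for k unfolding d_def by (rule from_nat_into[OF False])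
  interpret subseqs "\<lambda>k r. convergent (\<lambda>n. f (r n) (d k))"
  proof
    fix k and s :: "nat \<Rightarrow> nat" assume "strict_mono s"
    have "\<forall>n. f (s n) (d k) \<in> K" using K d by auto
    with \<open>compact K\<close> obtain l r' where "strict_mono r'" "((\<lambda>n. f (s n) (d k)) \<circ> r') \<longlonglongrightarrow> l"
      unfolding compact_def by (auto dest!: spec[of _ "\<lambda>n. f (s n) (d k)"])
    then show "\<exists>r'. strict_mono r' \<and> convergent (\<lambda>n. f ((s \<circ> r') n) (d k))"
      by (auto simp: convergent_def o_def)
  qed
  have "convergent (\<lambda>n. f (diagseq n) (d k))" for k
  proof -
    \<comment> \<open>The diagonal sequence refines stage \<open>k\<close> only from index
      \<open>Suc k\<close> on, hence the shift.\<close>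
    have "convergent (\<lambda>n. f ((diagseq \<circ> (+) (Suc k)) n) (d k))"
    proof (rule diagseq_holds)
      fix r s :: "nat \<Rightarrow> nat" and n assume "strict_mono r" "convergent (\<lambda>m. f (s m) (d n))"
      then show "convergent (\<lambda>m. f ((s \<circ> r) m) (d n))"
        using convergent_subseq_convergent[of "\<lambda>m. f (s m) (d n)" r] by (simp add: o_def)
    qed
    then show ?thesis
      using convergent_ignore_initial_segment[of "\<lambda>n. f (diagseq n) (d k)" "Suc k"] by (simp add: add.commute)
  qed
  then show ?thesis
    using that[OF subseq_diagseq] from_nat_into_surj[OF \<open>countable D\<close>] unfolding d_def by metis
qed

text \<open>A first extraction gives convergence of curves and variation functions on a countable
  dense set. Completeness extends it to all times where the limit variation has small increments; a
  second extraction handles the countably many other times.\<close>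

lemma Helly_selection_metric:
  fixes u :: "nat \<Rightarrow> real \<Rightarrow> 'a::complete_space"
  assumes "compact K" and K: "\<And>n t. t \<in> {0..T} \<Longrightarrow> u n t \<in> K"
    and V: "\<And>n. Var (u n) {0..T} \<le> ennreal V"
  obtains r w where "strict_mono r" "\<And>t. t \<in> {0..T} \<Longrightarrow> (\<lambda>n. u (r n) t) \<longlonglongrightarrow> w t"
proof -
  have BV: "BV T (u n)" for n unfolding BV_def
    using order.strict_trans1[OF V] by (metis ennreal_less_top infinity_ennreal_def)
  \<comment> \<open>Including both endpoints gives every time in \<open>[0, T]\<close> a point of
    \<open>D\<close> on either side.\<close>
  define D where "D = {0..T} \<inter> (\<rat> \<union> {0, T})"
  have "countable D" by (auto simp: D_def countable_rat)
  \<comment> \<open>For negative \<open>V\<close> the value \<open>ennreal V\<close> is 0, hence the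
    maximum.\<close>
  have "var_fun (u n) t \<in> {0..max 0 V}" if "t \<in> {0..T}" for n t
  proof -
    have "ennreal (var_fun (u n) t) \<le> ennreal V"
      using Var_eq_var_fun[OF BV, of t n] Var_mono[of "{0..t}" "{0..T}" "u n"] that V[of n] by auto
    then show ?thesis
      using var_fun_nonneg[of "u n" t] by (auto simp: ennreal_le_iff2)
  qed
  then have "(u n t, var_fun (u n) t) \<in> K \<times> {0..max 0 V}" if "t \<in> D" for n t
    using K that unfolding D_def by blast
  \<comment> \<open>Pairing each curve with its variation function makes one extraction serve
    both.\<close>
  from pointwise_convergent_subseq[where f="\<lambda>n x. (u n x, var_fun (u n) x)", OF \<open>countable D\<close> compact_Times[OF \<open>compact K\<close> compact_Icc] this]
  obtain r where r: "strict_mono r" and rc: "\<And>x. x \<in> D \<Longrightarrow> convergent (\<lambda>n. (u (r n) x, var_fun (u (r n)) x))"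
    by blast
  have rc': "convergent (\<lambda>n. u (r n) x) \<and> convergent (\<lambda>n. var_fun (u (r n)) x)" if x: "x \<in> D" for x
  proof -
    obtain l where "(\<lambda>n. (u (r n) x, var_fun (u (r n)) x)) \<longlonglongrightarrow> l"
      using rc[OF x] unfolding convergent_def by blast
    from tendsto_fst[OF this] tendsto_snd[OF this] show ?thesis by (auto simp: convergent_def)
  qed
  then obtain L where L: "\<And>x. x \<in> D \<Longrightarrow> (\<lambda>n. var_fun (u (r n)) x) \<longlonglongrightarrow> L x"
    unfolding convergent_def by metis
  have L_mono: "L x \<le> L y" if "x \<in> D" "y \<in> D" "x \<le> y" for x y
  proof (rule LIMSEQ_le[OF L L])
    have "var_fun (u (r n)) x \<le> var_fun (u (r n)) y" for n
      using that by (intro var_fun_mono[OF BV]) (auto simp: D_def)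
    then show "\<exists>N. \<forall>n\<ge>N. var_fun (u (r n)) x \<le> var_fun (u (r n)) y" by blast
  qed (use that in auto)
  (* Off Z, the distance from u n t to u n p with p in D is controlled by the variation on [p, q],
     uniformly in n; Z is contained in the discontinuities of the monotone extension M of L. *)
  define Z where "Z = {t \<in> {0..T}. \<not> (\<forall>\<epsilon>>0. \<exists>p\<in>D. \<exists>q\<in>D. p \<le> t \<and> t \<le> q \<and> L q - L p < \<epsilon>)}"
  have "countable Z"
  proof (cases "0 \<le> T")
    case True
    then have "0 \<in> D" "T \<in> D" by (auto simp: D_def)
    define M where "M t = Sup (L ` (D \<inter> {..t}))" for t
    have M_le: "M t \<le> L q" if "q \<in> D" "t \<le> q" "0 \<le> t" for t q
      unfolding M_def using \<open>0 \<in> D\<close> that by (intro cSUP_least) (auto intro!: L_mono)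
    have le_M: "L p \<le> M t" if "p \<in> D" "p \<le> t" for t p
      unfolding M_def using that \<open>T \<in> D\<close>
      by (intro cSUP_upper) (auto intro!: bdd_aboveI2[of _ _ "L T"] L_mono simp: D_def)
    have "mono_on {0..T} M"
    proof (rule mono_onI)
      fix x y assume xy: "x \<in> {0..T}" "y \<in> {0..T}" "x \<le> y"
      then show "M x \<le> M y" unfolding M_def[of x] using \<open>0 \<in> D\<close>
        by (intro cSUP_least) (auto intro!: le_M)
    qed
    \<comment> \<open>At a continuity point \<open>t\<close> of \<open>M\<close>, nearby points of
      \<open>D\<close> on either side have \<open>M\<close>-values within
      \<open>\<epsilon> / 2\<close> of \<open>M t\<close>. Since \<open>M\<close> agrees with
      \<open>L\<close> on \<open>D\<close>, such a \<open>t\<close> lies outside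
      \<open>Z\<close>.\<close>
    moreover have "Z \<subseteq> {t \<in> {0..T}. \<not> continuous (at t within {0..T}) M}"
    proof (clarsimp simp: Z_def)
      fix t \<epsilon> :: real
      assume t: "0 \<le> t" "t \<le> T" and c: "continuous (at t within {0..T}) M" and "\<epsilon> > 0"
        and non: "\<forall>p\<in>D. p \<le> t \<longrightarrow> (\<forall>q\<in>D. t \<le> q \<longrightarrow> \<not> L q - L p < \<epsilon>)"
      obtain \<delta> where \<delta>: "\<delta> > 0" "\<And>s. s \<in> {0..T} \<Longrightarrow> dist s t < \<delta> \<Longrightarrow> dist (M s) (M t) < \<epsilon> / 2"
        using c \<open>\<epsilon> > 0\<close> unfolding continuous_within_eps_delta by (metis half_gt_zero)
      have "\<exists>p\<in>D. p \<le> t \<and> dist p t < \<delta>"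
      proof (cases "t = 0")
        case False
        then have "max 0 (t - \<delta>) < t" using t \<delta> by auto
        then obtain p where "p \<in> \<rat>" "max 0 (t - \<delta>) < p" "p < t" using Rats_dense_in_real by blast
        then show ?thesis using t by (intro bexI[of _ p]) (auto simp: D_def dist_real_def)
      qed (use \<delta> \<open>0 \<in> D\<close> in auto)
      then obtain p where p: "p \<in> D" "p \<le> t" "dist p t < \<delta>" by auto
      have "\<exists>q\<in>D. t \<le> q \<and> dist q t < \<delta>"
      proof (cases "t = T")
        case False
        then have "t < min T (t + \<delta>)" using t \<delta> by auto
        then obtain q where "q \<in> \<rat>" "t < q" "q < min T (t + \<delta>)" using Rats_dense_in_real by blast
        then show ?thesis using t by (intro bexI[of _ q]) (auto simp: D_def dist_real_def)
      qed (use \<delta> \<open>T \<in> D\<close> in auto)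
      then obtain q where q: "q \<in> D" "t \<le> q" "dist q t < \<delta>" by auto
      have "M q = L q" "M p = L p"
        using p q M_le[of p p] le_M[of p p] M_le[of q q] le_M[of q q] by (auto simp: D_def)
      moreover have "dist (M p) (M t) < \<epsilon> / 2" "dist (M q) (M t) < \<epsilon> / 2"
        using p q t \<delta>(2)[of p] \<delta>(2)[of q] by (auto simp: D_def)
      ultimately have "L q - L p < \<epsilon>" unfolding dist_real_def by arith
      then show False using non p q by auto
    qed
    ultimately show ?thesis using mono_on_ctble_discont countable_subset by metis
  qed (auto simp: Z_def)
  have "u (r n) t \<in> K" if "t \<in> Z" for n t using K that unfolding Z_def by auto
  from pointwise_convergent_subseq[where f="\<lambda>n. u (r n)", OF \<open>countable Z\<close> \<open>compact K\<close> this]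
  obtain r' where r': "strict_mono r'" and r'c: "\<And>x. x \<in> Z \<Longrightarrow> convergent (\<lambda>n. u (r (r' n)) x)"
    by blast
  have "convergent (\<lambda>n. u (r n) t)" if t: "t \<in> {0..T} - Z" for t
  proof -
    have "Cauchy (\<lambda>n. u (r n) t)"
    proof (rule metric_CauchyI)
      fix \<epsilon> :: real assume "\<epsilon> > 0"
      then obtain p q where pq: "p \<in> D" "q \<in> D" "p \<le> t" "t \<le> q" "L q - L p < \<epsilon> / 3"
        using t unfolding Z_def by (auto dest!: spec[of _ "\<epsilon> / 3"])
      have "(\<lambda>n. var_fun (u (r n)) q - var_fun (u (r n)) p) \<longlonglongrightarrow> L q - L p"
        using pq by (intro tendsto_diff L)
      from order_tendstoD(2)[OF this pq(5)]
      obtain N where N: "\<And>n. n \<ge> N \<Longrightarrow> var_fun (u (r n)) q - var_fun (u (r n)) p < \<epsilon> / 3"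
        unfolding eventually_sequentially by blast
      obtain N' where N': "\<And>m n. m \<ge> N' \<Longrightarrow> n \<ge> N' \<Longrightarrow> dist (u (r m) p) (u (r n) p) < \<epsilon> / 3"
        using metric_CauchyD[OF convergent_Cauchy[OF conjunct1[OF rc'[OF pq(1)]]], of "\<epsilon> / 3"] \<open>\<epsilon> > 0\<close> by auto
      have close: "dist (u (r n) p) (u (r n) t) < \<epsilon> / 3" if "n \<ge> N" for n
        using N[OF that] dist_le_var_fun_diff[OF BV[of "r n"], of p t]
          var_fun_mono[OF BV[of "r n"], of t q] pq
        by (auto simp: D_def)
      have "dist (u (r m) t) (u (r n) t) < \<epsilon>" if "m \<ge> max N N'" "n \<ge> max N N'" for m n
        using close[of m] close[of n] N'[of m n] that
          dist_triangle[of "u (r m) t" "u (r n) t" "u (r m) p"] dist_triangle[of "u (r m) p" "u (r n) t" "u (r n) p"]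
        by (simp add: dist_commute)
      then show "\<exists>M. \<forall>m\<ge>M. \<forall>n\<ge>M. dist (u (r m) t) (u (r n) t) < \<epsilon>" by blast
    qed
    then show ?thesis by (simp add: Cauchy_convergent_iff)
  qed
  then have "convergent (\<lambda>n. u (r (r' n)) t)" if "t \<in> {0..T}" for t
    using r'c[of t] that convergent_subseq_convergent[OF _ r', of "\<lambda>n. u (r n) t"]
    by (cases "t \<in> Z") (auto simp: o_def)
  then have "\<forall>t\<in>{0..T}. \<exists>l. (\<lambda>n. u ((r \<circ> r') n) t) \<longlonglongrightarrow> l"
    by (simp add: convergent_def)
  from bchoice[OF this] obtain w where "\<forall>t\<in>{0..T}. (\<lambda>n. u ((r \<circ> r') n) t) \<longlonglongrightarrow> w t" ..
  then show ?thesis using that strict_mono_o[OF r r'] by blast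
qed

section \<open>Integral estimates by Fatou's lemma\<close>

text \<open>The integrals of \<open>m\<close> and its shift cancel except on the strips
  \<open>[t - h, t]\<close> and \<open>[- h, 0]\<close>, each of length \<open>h\<close>, where
  monotonicity bounds \<open>m\<close> by \<open>m t\<close> above and by \<open>m (- h)\<close>
  below.\<close>

lemma integral_difference_quotient_le:
  fixes m :: "real \<Rightarrow> real"
  assumes "mono m" "0 < h" "0 \<le> t"
  shows "(\<integral>\<^sup>+s\<in>{0..t}. ennreal ((m s - m (s - h)) / h) \<partial>lebesgue) \<le> ennreal (m t - m (- h))"
proof -
  have int: "m integrable_on {a..b}" for a b
    using \<open>mono m\<close> by (intro integrable_on_mono_on) (auto simp: mono_on_def mono_def)
  have "((\<lambda>s. m (s - h)) has_integral integral {- h..t - h} m) {0..t}"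
    using has_integral_affinity'[of m _ "- h" "t - h" 1 "- h"] integrable_integral[OF int[of "- h" "t - h"]] by simp
  from has_integral_diff[OF integrable_integral[OF int[of 0 t]] this]
  have "((\<lambda>s. (m s - m (s - h)) / h) has_integral (integral {0..t} m - integral {- h..t - h} m) / h) {0..t}"
    by (rule has_integral_divide)
  then have "(\<integral>\<^sup>+s\<in>{0..t}. ennreal ((m s - m (s - h)) / h) \<partial>lebesgue) = ennreal ((integral {0..t} m - integral {- h..t - h} m) / h)"
    unfolding nn_integral_completion using assms
    by (intro nn_integral_has_integral_lebesgue') (auto simp: mono_def)
  also have "\<dots> \<le> ennreal (m t - m (- h))"
  proof (rule ennreal_leI)
    have "integral {- h..t - h} m + integral {t - h..t} m = integral {- h..t} m"
      "integral {- h..0} m + integral {0..t} m = integral {- h..t} m"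
      using assms by (intro Henstock_Kurzweil_Integration.integral_combine int; simp)+
    then have "integral {0..t} m - integral {- h..t - h} m = integral {t - h..t} m - integral {- h..0} m"
      by simp
    moreover have "integral {t - h..t} m \<le> integral {t - h..t} (\<lambda>_. m t)"
      using assms by (intro integral_le int) (auto simp: mono_def)
    moreover have "integral {- h..0} m \<ge> integral {- h..0} (\<lambda>_. m (- h))"
      using assms by (intro integral_le int) (auto simp: mono_def)
    ultimately show "(integral {0..t} m - integral {- h..t - h} m) / h \<le> m t - m (- h)"
      using assms by (simp add: field_simps)
  qed
  finally show ?thesis .
qed

lemma liminf_set_nn_integral_le:
  fixes f :: "nat \<Rightarrow> 'a \<Rightarrow> ennreal"
  assumes "\<And>n. f n \<in> borel_measurable M" "A \<in> sets M"
  shows "(\<integral>\<^sup>+x\<in>A. liminf (\<lambda>n. f n x) \<partial>M) \<le> liminf (\<lambda>n. \<integral>\<^sup>+x\<in>A. f n x \<partial>M)"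
proof -
  have "(\<integral>\<^sup>+x\<in>A. liminf (\<lambda>n. f n x) \<partial>M) = (\<integral>\<^sup>+x. liminf (\<lambda>n. f n x * indicator A x) \<partial>M)"
    by (intro nn_integral_cong) (auto split: split_indicator simp: Liminf_const)
  also have "\<dots> \<le> liminf (\<lambda>n. \<integral>\<^sup>+x\<in>A. f n x \<partial>M)"
    using assms by (intro nn_integral_liminf) auto
  finally show ?thesis .
qed

lemma AE_lebesgue_notin_countable: "countable (N :: real set) \<Longrightarrow> AE s in lebesgue. s \<notin> N"
  by (intro AE_completion AE_not_in countable_imp_null_set_lborel)

text \<open>\<open>Q\<close> is the lower limit of backward difference quotients of a monotone
  version of \<open>e s + B * s\<close>; the shift by \<open>B\<close> makes them nonnegative. The
  Dini bound estimates \<open>Q\<close> from below, Fatou's lemma and telescoping estimate its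
  integral from above.\<close>

lemma Fatou_lower_dini:
  fixes e p :: "real \<Rightarrow> real"
  assumes "0 \<le> T" and S: "S \<subseteq> {0..T}" "0 \<in> S" "countable ({0..T} - S)"
    and incr: "\<And>s t. \<lbrakk>s \<in> S; t \<in> {0..T}; s \<le> t\<rbrakk> \<Longrightarrow> e s + B * s \<le> e t + B * t"
    and dini: "\<And>t \<epsilon>. \<lbrakk>t \<in> S; 0 < t; 0 < \<epsilon>\<rbrakk> \<Longrightarrow> \<forall>\<^sub>F s in at_left t. s \<in> S \<longrightarrow> (p t - \<epsilon>) * (t - s) \<le> e t - e s"
  obtains Q :: "real \<Rightarrow> ennreal" where "Q \<in> borel_measurable lebesgue"
    "AE s in lebesgue. s \<in> {0..T} \<longrightarrow> ennreal (p s + B) \<le> Q s"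
    "\<And>t. t \<in> {0..T} \<Longrightarrow> (\<integral>\<^sup>+s\<in>{0..t}. Q s \<partial>lebesgue) \<le> ennreal (e t - e 0 + B * t)"
proof -
  (* e is not known to be measurable; m is monotone, hence Borel, and equals e(x) + B x on S. *)
  define m where "m x = Sup ((\<lambda>r. e r + B * r) ` (S \<inter> {..max 0 x}))" for x
  have bdd: "bdd_above ((\<lambda>r. e r + B * r) ` (S \<inter> A))" for A
    using S \<open>0 \<le> T\<close> by (intro bdd_aboveI2[of _ _ "e T + B * T"] incr) auto
  have "mono m"
    unfolding m_def using S bdd by (intro monoI cSUP_subset_mono) auto
  \<comment> \<open>This holds at all times, also off \<open>S\<close>, and has the direction needed
    for the upper endpoint of the telescoped integral.\<close>
  have m_le: "m x \<le> e x + B * x" if "x \<in> {0..T}" for x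
    unfolding m_def using S that by (intro cSUP_least incr) auto
  have m_S: "m x = e x + B * x" if "x \<in> S" for x
  proof (rule antisym)
    show "m x \<le> e x + B * x" using that S by (intro m_le) auto
    show "e x + B * x \<le> m x" unfolding m_def using that by (intro cSUP_upper bdd) auto
  qed
  \<comment> \<open>The constant extension to the left defines the backward quotients near 0 and
    makes the lower boundary term equal to \<open>e 0\<close>.\<close>
  have m_neg: "m x = e 0" if "x \<le> 0" for x
  proof -
    have "S \<inter> {..max 0 x} = {0}" using S that by auto
    then show ?thesis by (simp add: m_def)
  qed
  define h :: "nat \<Rightarrow> real" where "h k = 1 / real (Suc k)" for k
  have h: "h k > 0" for k by (simp add: h_def)
  have h_lim: "h \<longlonglongrightarrow> 0" unfolding h_def by (rule lim_1_over_n[THEN LIMSEQ_Suc])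
  define q where "q k s = ennreal ((m s - m (s - h k)) / h k)" for k s
  define Q where "Q s = liminf (\<lambda>k. q k s)" for s
  have [measurable]: "m \<in> borel_measurable borel" by (rule borel_measurable_mono[OF \<open>mono m\<close>])
  have q_meas: "q k \<in> borel_measurable lebesgue" for k
    unfolding q_def by (intro measurable_completion) measurable
  show ?thesis
  proof
    show "Q \<in> borel_measurable lebesgue" unfolding Q_def using q_meas by measurable
    fix t assume t: "t \<in> {0..T}"
    have "(\<integral>\<^sup>+s\<in>{0..t}. Q s \<partial>lebesgue) \<le> liminf (\<lambda>k. \<integral>\<^sup>+s\<in>{0..t}. q k s \<partial>lebesgue)"
      unfolding Q_def by (rule liminf_set_nn_integral_le[OF q_meas]) simp
    also have "\<dots> \<le> ennreal (e t - e 0 + B * t)"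
    proof (rule Liminf_le[OF sequentially_bot always_eventually], rule allI)
      fix k
      have "(\<integral>\<^sup>+s\<in>{0..t}. q k s \<partial>lebesgue) \<le> ennreal (m t - m (- h k))"
        unfolding q_def using t h by (intro integral_difference_quotient_le \<open>mono m\<close>) auto
      also have "\<dots> \<le> ennreal (e t - e 0 + B * t)"
        using m_le[OF t] m_neg[of "- h k"] h[of k] by (intro ennreal_leI) simp
      finally show "(\<integral>\<^sup>+s\<in>{0..t}. q k s \<partial>lebesgue) \<le> ennreal (e t - e 0 + B * t)" .
    qed
    finally show "(\<integral>\<^sup>+s\<in>{0..t}. Q s \<partial>lebesgue) \<le> ennreal (e t - e 0 + B * t)" .
  next
    \<comment> \<open>Both \<open>s\<close> and \<open>s - h k\<close> must lie in \<open>S\<close>.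
      The translates of the complement by all steps \<open>h k\<close> are therefore excluded too;
      their union remains countable.\<close>
    let ?Z = "{0..T} - S"
    let ?N = "insert 0 (?Z \<union> (\<Union>k. (\<lambda>z. z + h k) ` ?Z))"
    have "countable ?N" using S(3) by auto
    from AE_lebesgue_notin_countable[OF this]
    show "AE s in lebesgue. s \<in> {0..T} \<longrightarrow> ennreal (p s + B) \<le> Q s"
    proof (rule eventually_mono, intro impI)
      fix s assume s: "s \<notin> ?N" "s \<in> {0..T}"
      then have "s \<in> S" "s > 0" by auto
      have shift: "s - h k \<in> S" if "h k \<le> s" for k
      proof (rule ccontr)
        assume "s - h k \<notin> S"
        then have "s - h k \<in> ?Z" using that s h[of k] by auto
        then have "s \<in> (\<lambda>z. z + h k) ` ?Z" by (rule rev_image_eqI) simp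
        then show False using s by blast
      qed
      have approx: "ennreal (p s + B - \<epsilon>) \<le> Q s" if "\<epsilon> > 0" for \<epsilon>
        unfolding Q_def
      proof (rule Liminf_bounded)
        have "((\<lambda>k. s - h k) \<longlongrightarrow> s - 0) sequentially" by (intro tendsto_intros h_lim)
        then have "filterlim (\<lambda>k. s - h k) (at_left s) sequentially"
          using h less_imp_neq[OF h, symmetric] by (auto simp: filterlim_at)
        from eventually_compose_filterlim[OF dini[OF \<open>s \<in> S\<close> \<open>s > 0\<close> \<open>\<epsilon> > 0\<close>] this]
        have "\<forall>\<^sub>F k in sequentially. s - h k \<in> S \<longrightarrow> (p s - \<epsilon>) * (s - (s - h k)) \<le> e s - e (s - h k)" .
        moreover have "\<forall>\<^sub>F k in sequentially. h k < s" using h_lim \<open>s > 0\<close> by (rule order_tendstoD(2))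
        ultimately show "\<forall>\<^sub>F k in sequentially. ennreal (p s + B - \<epsilon>) \<le> q k s"
        proof eventually_elim
          case (elim k)
          then have "s - h k \<in> S" by (intro shift) simp
          with elim m_S[OF this] m_S[OF \<open>s \<in> S\<close>] have "(p s + B - \<epsilon>) * h k \<le> m s - m (s - h k)"
            by (simp add: algebra_simps)
          then show ?case unfolding q_def using h[of k] by (intro ennreal_leI) (simp add: pos_le_divide_eq)
        qed
      qed
      \<comment> \<open>The slack \<epsilon> is sent to 0 along the sequence \<open>h\<close>, only
        after the lower limit has been taken.\<close>
      have "(\<lambda>k. ennreal (p s + B - h k)) \<longlonglongrightarrow> ennreal (p s + B - 0)"
        by (intro tendsto_ennrealI tendsto_intros h_lim)
      then show "ennreal (p s + B) \<le> Q s"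
        using approx[OF h] by (intro LIMSEQ_le_const2[where a="Q s"]) auto
    qed
  qed
qed

text \<open>The shift by the bound \<open>B\<close> makes both integrands nonnegative, so
  \<open>ennreal\<close> truncates nothing and nonnegative integrals translate into Lebesgue
  integrals.\<close>

lemma set_nn_integral_offset:
  fixes f :: "real \<Rightarrow> real"
  assumes "set_integrable lebesgue {0..t} f" "\<And>s. s \<in> {0..t} \<Longrightarrow> \<bar>f s\<bar> \<le> B" "0 \<le> t"
  shows "(\<integral>\<^sup>+s\<in>{0..t}. ennreal (B + f s) \<partial>lebesgue) = ennreal (B * t + (LINT s:{0..t}|lebesgue. f s))"
    and "(\<integral>\<^sup>+s\<in>{0..t}. ennreal (B - f s) \<partial>lebesgue) = ennreal (B * t - (LINT s:{0..t}|lebesgue. f s))"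
    and "\<bar>LINT s:{0..t}|lebesgue. f s\<bar> \<le> B * t"
proof -
  have f: "(f has_integral (LINT s:{0..t}|lebesgue. f s)) {0..t}"
    by (rule has_integral_set_lebesgue[OF assms(1)])
  have c: "((\<lambda>_. B) has_integral B * t) {0..t}"
    using has_integral_const_real[of B 0 t] \<open>0 \<le> t\<close> by (simp add: mult.commute)
  have nn: "0 \<le> B + f s" "0 \<le> B - f s" if "s \<in> {0..t}" for s using assms(2)[OF that] by auto
  show "(\<integral>\<^sup>+s\<in>{0..t}. ennreal (B + f s) \<partial>lebesgue) = ennreal (B * t + (LINT s:{0..t}|lebesgue. f s))"
    unfolding nn_integral_completion by (rule nn_integral_has_integral_lebesgue'[OF nn(1) has_integral_add[OF c f]])
  show "(\<integral>\<^sup>+s\<in>{0..t}. ennreal (B - f s) \<partial>lebesgue) = ennreal (B * t - (LINT s:{0..t}|lebesgue. f s))"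
    unfolding nn_integral_completion by (rule nn_integral_has_integral_lebesgue'[OF nn(2) has_integral_diff[OF c f]])
  show "\<bar>LINT s:{0..t}|lebesgue. f s\<bar> \<le> B * t"
    using has_integral_nonneg[OF has_integral_add[OF c f] nn(1)] has_integral_nonneg[OF has_integral_diff[OF c f] nn(2)] by simp
qed

text \<open>Reverse Fatou: the lemma is applied to the nonnegative functions \<open>B - f n\<close>.
  Their lower limit \<open>G\<close> is measurable although \<open>p\<close> is not known to
  be.\<close>

lemma Fatou_upper:
  fixes f :: "nat \<Rightarrow> real \<Rightarrow> real" and p :: "real \<Rightarrow> real"
  assumes "0 \<le> T" "countable ({0..T} - S)"
    and int: "\<And>n. set_integrable lebesgue {0..T} (f n)"
    and bound: "\<And>n s. s \<in> {0..T} \<Longrightarrow> \<bar>f n s\<bar> \<le> B"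
    and limsup: "\<And>s \<epsilon>. \<lbrakk>s \<in> S; 0 < \<epsilon>\<rbrakk> \<Longrightarrow> \<forall>\<^sub>F n in sequentially. f n s < p s + \<epsilon>"
  obtains G :: "real \<Rightarrow> ennreal" where "G \<in> borel_measurable lebesgue"
    "AE s in lebesgue. s \<in> {0..T} \<longrightarrow> ennreal (B - p s) \<le> G s"
    "\<And>t. t \<in> {0..T} \<Longrightarrow> (\<integral>\<^sup>+s\<in>{0..t}. G s \<partial>lebesgue) \<le> liminf (\<lambda>n. ennreal (B * t - (LINT s:{0..t}|lebesgue. f n s)))"
proof -
  \<comment> \<open>The indicator is present because \<open>f n\<close> is only known to be
    measurable on \<open>[0, T]\<close>.\<close>
  define g where "g n s = ennreal (B - indicator {0..T} s * f n s)" for n s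
  define G where "G s = liminf (\<lambda>n. g n s)" for s
  have [measurable]: "(\<lambda>s. indicator {0..T} s * f n s) \<in> borel_measurable lebesgue" for n
    using int[of n] unfolding set_integrable_def by (auto dest: borel_measurable_integrable)
  have g_meas [measurable]: "g n \<in> borel_measurable lebesgue" for n
    unfolding g_def by measurable
  show ?thesis
  proof
    show "G \<in> borel_measurable lebesgue" unfolding G_def by measurable
    fix t assume t: "t \<in> {0..T}"
    have eq: "(\<integral>\<^sup>+s\<in>{0..t}. g n s \<partial>lebesgue) = ennreal (B * t - (LINT s:{0..t}|lebesgue. f n s))" for n
    proof -
      have "set_integrable lebesgue {0..t} (f n)"
        using t by (intro set_integrable_subset[OF int]) auto
      from set_nn_integral_offset(2)[OF this] t bound
      have "(\<integral>\<^sup>+s\<in>{0..t}. ennreal (B - f n s) \<partial>lebesgue) = ennreal (B * t - (LINT s:{0..t}|lebesgue. f n s))"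
        by auto
      moreover have "(\<integral>\<^sup>+s\<in>{0..t}. g n s \<partial>lebesgue) = (\<integral>\<^sup>+s\<in>{0..t}. ennreal (B - f n s) \<partial>lebesgue)"
        using t by (intro nn_integral_cong) (auto simp: g_def split: split_indicator)
      ultimately show ?thesis by simp
    qed
    have "(\<integral>\<^sup>+s\<in>{0..t}. G s \<partial>lebesgue) \<le> liminf (\<lambda>n. \<integral>\<^sup>+s\<in>{0..t}. g n s \<partial>lebesgue)"
      unfolding G_def by (rule liminf_set_nn_integral_le[OF g_meas]) simp
    then show "(\<integral>\<^sup>+s\<in>{0..t}. G s \<partial>lebesgue) \<le> liminf (\<lambda>n. ennreal (B * t - (LINT s:{0..t}|lebesgue. f n s)))"
      unfolding eq .
  next
    from AE_lebesgue_notin_countable[OF assms(2)]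
    show "AE s in lebesgue. s \<in> {0..T} \<longrightarrow> ennreal (B - p s) \<le> G s"
    proof (rule eventually_mono, intro impI)
      fix s assume s: "s \<notin> {0..T} - S" "s \<in> {0..T}"
      have "ennreal (B - p s - 1 / real (Suc k)) \<le> G s" for k
        unfolding G_def
      proof (rule Liminf_bounded)
        have "\<forall>\<^sub>F n in sequentially. f n s < p s + 1 / real (Suc k)" using s by (intro limsup) auto
        then show "\<forall>\<^sub>F n in sequentially. ennreal (B - p s - 1 / real (Suc k)) \<le> g n s"
          by eventually_elim (use s in \<open>auto simp: g_def intro!: ennreal_leI\<close>)
      qed
      moreover have "(\<lambda>k. ennreal (B - p s - 1 / real (Suc k))) \<longlonglongrightarrow> ennreal (B - p s - 0)"
        by (intro tendsto_ennrealI tendsto_intros lim_1_over_n[THEN LIMSEQ_Suc])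
      ultimately show "ennreal (B - p s) \<le> G s"
        by (intro LIMSEQ_le_const2[where a="G s"]) auto
    qed
  qed
qed

text \<open>Measurability of \<open>p\<close> is not assumed: \<open>Q + G\<close> is at least \<open>2 * B\<close> almost everywhere, but its integral is at
  most \<open>2 * B * T\<close>, so \<open>p = Q - B\<close> almost everywhere.\<close>

lemma sandwiched_integral:
  fixes p a :: "real \<Rightarrow> real" and Q G :: "real \<Rightarrow> ennreal"
  assumes "0 \<le> T" and [measurable]: "Q \<in> borel_measurable lebesgue" "G \<in> borel_measurable lebesgue"
    and Q: "AE s in lebesgue. s \<in> {0..T} \<longrightarrow> ennreal (B + p s) \<le> Q s"
    and G: "AE s in lebesgue. s \<in> {0..T} \<longrightarrow> ennreal (B - p s) \<le> G s"
    and p: "\<And>s. s \<in> {0..T} \<Longrightarrow> \<bar>p s\<bar> \<le> B"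
    and Q_le: "\<And>t. t \<in> {0..T} \<Longrightarrow> (\<integral>\<^sup>+s\<in>{0..t}. Q s \<partial>lebesgue) \<le> ennreal (B * t + a t)"
    and G_le: "\<And>t. t \<in> {0..T} \<Longrightarrow> (\<integral>\<^sup>+s\<in>{0..t}. G s \<partial>lebesgue) \<le> ennreal (B * t - a t)"
    and a: "\<And>t. t \<in> {0..T} \<Longrightarrow> \<bar>a t\<bar> \<le> B * t"
  shows "set_integrable lebesgue {0..T} p"
    and "\<And>t. t \<in> {0..T} \<Longrightarrow> (LINT s:{0..t}|lebesgue. p s) = a t"
proof -
  have "0 \<le> B" using p[of 0] \<open>0 \<le> T\<close> by auto
  have [measurable]: "(indicator {0..T} :: real \<Rightarrow> ennreal) \<in> borel_measurable lebesgue"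
    "(indicator {0..T} :: real \<Rightarrow> real) \<in> borel_measurable lebesgue"
    by (rule borel_measurable_indicator; simp)+
  let ?f = "\<lambda>s. (Q s + G s) * indicator {0..T} s" and ?g = "\<lambda>s. ennreal (2 * B) * indicator {0..T} s"
  have g: "integral\<^sup>N lebesgue ?g = ennreal (2 * B * T)"
    using \<open>0 \<le> T\<close> \<open>0 \<le> B\<close> by (simp add: nn_integral_cmult_indicator flip: ennreal_mult)
  have "integral\<^sup>N lebesgue ?f = (\<integral>\<^sup>+s\<in>{0..T}. Q s \<partial>lebesgue) + (\<integral>\<^sup>+s\<in>{0..T}. G s \<partial>lebesgue)"
    unfolding distrib_right by (rule nn_integral_add) measurable
  also have "\<dots> \<le> ennreal (B * T + a T) + ennreal (B * T - a T)"
    using \<open>0 \<le> T\<close> by (intro add_mono Q_le G_le) auto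
  also have "\<dots> = ennreal (2 * B * T)"
    using a[of T] \<open>0 \<le> T\<close> by (simp add: abs_le_iff flip: ennreal_plus)
  finally have f: "integral\<^sup>N lebesgue ?f \<le> ennreal (2 * B * T)" .
  have ge: "AE s in lebesgue. ?g s \<le> ?f s"
    using Q G
  proof eventually_elim
    case (elim s)
    have "ennreal (2 * B) \<le> Q s + G s" if s: "s \<in> {0..T}"
    proof -
      have "ennreal (2 * B) = ennreal (B + p s) + ennreal (B - p s)"
        using p[OF s] by (simp add: abs_le_iff flip: ennreal_plus)
      also have "\<dots> \<le> Q s + G s" using elim s by (intro add_mono) auto
      finally show ?thesis .
    qed
    then show ?case by (simp split: split_indicator)
  qed
  \<comment> \<open>Since \<open>?g \<le> ?f\<close> almost everywhere and the integral of
    \<open>?f\<close> is no larger than that of \<open>?g\<close>, the two functions agree almost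
    everywhere.\<close>
  have "(\<integral>\<^sup>+s. ?f s - ?g s \<partial>lebesgue) = integral\<^sup>N lebesgue ?f - integral\<^sup>N lebesgue ?g"
    by (rule nn_integral_diff) (use g ge in auto)
  also have "\<dots> = 0" using f order.strict_trans1[OF f ennreal_less_top] unfolding g by (simp add: diff_eq_0_iff_ennreal)
  finally have "AE s in lebesgue. ?f s - ?g s = 0"
    by (subst (asm) nn_integral_0_iff_AE) auto
  with Q G have "AE s in lebesgue. indicator {0..T} s * (enn2real (Q s) - B) = indicator {0..T} s * p s"
  proof eventually_elim
    case (elim s)
    \<comment> \<open>Two lower bounds with sum \<open>2 * B\<close>, against an upper bound
      \<open>2 * B\<close> for the sum, leave no slack in either.\<close>
    have "enn2real (Q s) = B + p s" if s: "s \<in> {0..T}"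
    proof -
      have le: "Q s + G s \<le> ennreal (2 * B)" using elim(3) s by (auto simp: diff_eq_0_iff_ennreal)
      have "Q s < top" "G s < top"
        by (rule order.strict_trans1[OF order_trans[OF _ le] ennreal_less_top]; simp)+
      then obtain x y where xy: "Q s = ennreal x" "0 \<le> x" "G s = ennreal y" "0 \<le> y"
        by (cases "Q s"; cases "G s") auto
      have "x + y \<le> 2 * B" using le xy \<open>0 \<le> B\<close> by (simp flip: ennreal_plus)
      moreover have "B + p s \<le> x" "B - p s \<le> y" using elim(1,2) s xy by auto
      ultimately show ?thesis using xy by simp
    qed
    then show ?case by (simp split: split_indicator)
  qed
  \<comment> \<open>Lebesgue measure is complete, so measurability passes across an almost
    everywhere equality.\<close>
  then have p_meas: "(\<lambda>s. indicator {0..T} s * p s) \<in> borel_measurable lebesgue"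
    by (rule borel_measurable_AE[rotated]) measurable
  have "integrable lebesgue (\<lambda>s. indicator {0..T} s * B)"
    by (simp add: integrable_mult_left_iff emeasure_lborel_Icc_eq integrable_real_indicator)
  then have "integrable lebesgue (\<lambda>s. indicator {0..T} s * p s)"
    by (rule Bochner_Integration.integrable_bound[OF _ p_meas])
      (auto simp: indicator_def intro!: AE_I2 order_trans[OF p])
  then show int: "set_integrable lebesgue {0..T} p"
    by (simp add: set_integrable_def)
  fix t assume t: "t \<in> {0..T}"
  have int_t: "set_integrable lebesgue {0..t} p" using t by (intro set_integrable_subset[OF int]) auto
  note off = set_nn_integral_offset[OF int_t, of B]
  \<comment> \<open>\<open>Q\<close> bounds the integral of \<open>p\<close> from above and
    \<open>G\<close> from below. The bound on \<open>a t\<close> makes the right-hand sides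
    nonnegative, so the inequalities descend to the reals.\<close>
  have "(\<integral>\<^sup>+s\<in>{0..t}. ennreal (B + p s) \<partial>lebesgue) \<le> (\<integral>\<^sup>+s\<in>{0..t}. Q s \<partial>lebesgue)"
    using Q t by (intro nn_integral_mono_AE) (auto elim!: eventually_mono split: split_indicator)
  also note Q_le[OF t]
  finally have 1: "(LINT s:{0..t}|lebesgue. p s) \<le> a t"
    using off(1) p t a[OF t] by (simp add: ennreal_le_iff abs_le_iff)
  have "(\<integral>\<^sup>+s\<in>{0..t}. ennreal (B - p s) \<partial>lebesgue) \<le> (\<integral>\<^sup>+s\<in>{0..t}. G s \<partial>lebesgue)"
    using G t by (intro nn_integral_mono_AE) (auto elim!: eventually_mono split: split_indicator)
  also note G_le[OF t]
  finally have "a t \<le> (LINT s:{0..t}|lebesgue. p s)"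
    using off(2) p t a[OF t] by (simp add: ennreal_le_iff abs_le_iff)
  with 1 show "(LINT s:{0..t}|lebesgue. p s) = a t" by simp
qed

section \<open>Energy bounds and the limit passage\<close>

text \<open>One growth constant \<open>C\<close> from (E2) is fixed so that the estimates can carry
  it; (E3) enters only in the limit passage.\<close>

locale rate_independent_system =
  fixes T :: real and E P :: "real \<Rightarrow> 'a::complete_space \<Rightarrow> real" and xo :: 'a and C :: real
  assumes T_pos: "0 < T" and C_pos: "0 < C"
    and E1: "cond_E1 T E xo"
    and Liminf_left: "\<And>t u. t \<in> {0<..T} \<Longrightarrow>
      Liminf (at_left t) (\<lambda>s. ereal ((E t u - E s u) / (t - s))) \<ge> ereal (P t u)"
    and Limsup_right: "\<And>t u. t \<in> {0..<T} \<Longrightarrow>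
      ereal (P t u) \<ge> Limsup (at_right t) (\<lambda>s. ereal ((E s u - E t u) / (s - t)))"
    and P_bound: "\<And>t u. t \<in> {0..T} \<Longrightarrow> \<bar>P t u\<bar> \<le> C * perturbed E xo t u"
begin

abbreviation F where "F \<equiv> perturbed E xo"

lemma F_nonneg: "t \<in> {0..T} \<Longrightarrow> 0 \<le> F t u"
  using order_trans[OF abs_ge_zero P_bound[of t u]] C_pos by (simp add: zero_le_mult_iff)

text \<open>Compact sublevels are closed, which is joint lower semicontinuity of \<open>F\<close> on
  \<open>[0, T]\<close> times the space.\<close>

lemma eventually_F_less:
  assumes "(\<tau> \<longlongrightarrow> t) G" "(w \<longlongrightarrow> u) G" "\<forall>\<^sub>F x in G. \<tau> x \<in> {0..T}" "c < F t u"
  shows "\<forall>\<^sub>F x in G. c < F (\<tau> x) (w x)"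
proof -
  have "open (- perturbed_sublevel T E xo c)"
    using E1 unfolding cond_E1_def by (intro open_Compl compact_imp_closed) blast
  moreover have "(t, u) \<in> - perturbed_sublevel T E xo c"
    using assms(4) by (simp add: perturbed_sublevel_def)
  ultimately have "\<forall>\<^sub>F x in G. (\<tau> x, w x) \<in> - perturbed_sublevel T E xo c"
    by (rule topological_tendstoD[OF tendsto_Pair[OF assms(1,2)]])
  with assms(3) show ?thesis
    by eventually_elim (simp add: perturbed_sublevel_def)
qed

text \<open>Subtracting the continuous distance term from \<open>F\<close> preserves lower
  semicontinuity; half the gap is spent on each.\<close>

lemma eventually_E_less:
  assumes "(\<tau> \<longlongrightarrow> t) G" "(w \<longlongrightarrow> u) G" "\<forall>\<^sub>F x in G. \<tau> x \<in> {0..T}" "c < E t u"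
  shows "\<forall>\<^sub>F x in G. c < E (\<tau> x) (w x)"
proof -
  define \<delta> where "\<delta> = (E t u - c) / 2"
  have "\<delta> > 0" using assms(4) by (simp add: \<delta>_def)
  have "\<forall>\<^sub>F x in G. c + \<delta> + dist xo u < F (\<tau> x) (w x)"
    using assms(4) by (intro eventually_F_less[OF assms(1-3)]) (simp add: perturbed_def \<delta>_def field_simps)
  moreover have "((\<lambda>x. dist xo (w x)) \<longlongrightarrow> dist xo u) G"
    by (intro tendsto_intros assms)
  then have "\<forall>\<^sub>F x in G. dist xo (w x) < dist xo u + \<delta>"
    using \<open>\<delta> > 0\<close> by (auto dest: order_tendstoD(2)[of _ _ _ "dist xo u + \<delta>"])
  ultimately show ?thesis
    by eventually_elim (simp add: perturbed_def)
qed

lemma E_left_diff_ge: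
  assumes "t \<in> {0<..T}" "\<epsilon> > 0"
  shows "\<forall>\<^sub>F s in at_left t. (P t u - \<epsilon>) * (t - s) \<le> E t u - E s u"
proof -
  have "\<forall>\<^sub>F s in at_left t. ereal (P t u - \<epsilon>) < ereal ((E t u - E s u) / (t - s))"
    using Liminf_left[OF assms(1), of u] \<open>\<epsilon> > 0\<close> unfolding le_Liminf_iff
    by (auto dest!: spec[of _ "ereal (P t u - \<epsilon>)"])
  moreover have "\<forall>\<^sub>F s in at_left t. s < t" by (simp add: eventually_at_filter)
  ultimately show ?thesis
    by eventually_elim (simp add: field_simps)
qed

lemma E_right_diff_le:
  assumes "t \<in> {0..<T}" "\<epsilon> > 0"
  shows "\<forall>\<^sub>F s in at_right t. E s u - E t u \<le> (P t u + \<epsilon>) * (s - t)"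
proof -
  have "\<forall>\<^sub>F s in at_right t. ereal ((E s u - E t u) / (s - t)) < ereal (P t u + \<epsilon>)"
    using Limsup_right[OF assms(1), of u] \<open>\<epsilon> > 0\<close> unfolding Limsup_le_iff
    by (auto dest!: spec[of _ "ereal (P t u + \<epsilon>)"])
  moreover have "\<forall>\<^sub>F s in at_right t. t < s" by (simp add: eventually_at_filter)
  ultimately show ?thesis
    by eventually_elim (simp add: field_simps)
qed

text \<open>The distance term is constant in time, so \<open>F\<close> has the increments of
  \<open>E\<close>, and the power bound gives an upper right Dini derivative of at most
  \<open>C * F\<close>.\<close>

lemma F_gronwall_forward:
  assumes "0 \<le> s" "s \<le> t" "t \<le> T"
  shows "F t u \<le> exp (C * (t - s)) * F s u"
proof (rule right_dini_gronwall[OF \<open>s \<le> t\<close>])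
  fix x c assume x: "s < x" "x \<le> t" "c < F x u"
  have "\<forall>\<^sub>F y in at_left x. y \<in> {0..T}"
    using eventually_at_left_real[OF x(1)] by eventually_elim (use x assms in auto)
  then show "\<forall>\<^sub>F y in at_left x. c < F y u"
    using eventually_F_less[OF _ tendsto_const, of "\<lambda>y. y" x "at_left x" c u] x(3) by (simp add: tendsto_ident_at)
next
  fix x \<epsilon> :: real assume x: "s \<le> x" "x < t" "\<epsilon> > 0"
  have "\<forall>\<^sub>F y in at_right x. E y u - E x u \<le> (P x u + \<epsilon>) * (y - x)"
    using x assms by (intro E_right_diff_le) auto
  moreover have "\<forall>\<^sub>F y in at_right x. x < y" by (simp add: eventually_at_filter)
  ultimately show "\<forall>\<^sub>F y in at_right x. F y u \<le> F x u + (C * F x u + \<epsilon>) * (y - x)"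
  proof eventually_elim
    case (elim y)
    have "(P x u + \<epsilon>) * (y - x) \<le> (C * F x u + \<epsilon>) * (y - x)"
      using P_bound[of x u] x assms elim by (intro mult_right_mono) auto
    then show ?case using elim by (simp add: perturbed_def algebra_simps)
  qed
qed (use assms C_pos in \<open>auto intro: F_nonneg\<close>)

text \<open>Time reversal turns the left-sided bound of (E2) into the right-sided hypothesis of
  Gronwall's inequality.\<close>

lemma F_gronwall_backward:
  assumes "0 \<le> s" "s \<le> t" "t \<le> T"
  shows "F s u \<le> exp (C * (t - s)) * F t u"
proof -
  have "F (- (- s)) u \<le> exp (C * (- s - (- t))) * F (- (- t)) u"
  proof (rule right_dini_gronwall[where g="\<lambda>x. F (- x) u"])
    fix x c assume x: "- t < x" "x \<le> - s" "c < F (- x) u"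
    have "\<forall>\<^sub>F y in at_left x. - y \<in> {0..T}"
      using eventually_at_left_real[OF x(1)] by eventually_elim (use x assms in auto)
    then show "\<forall>\<^sub>F y in at_left x. c < F (- y) u"
      using eventually_F_less[OF _ tendsto_const, of uminus "- x" "at_left x" c u] x(3)
      by (simp add: tendsto_minus tendsto_ident_at)
  next
    fix x \<epsilon> :: real assume x: "- t \<le> x" "x < - s" "\<epsilon> > 0"
    have "\<forall>\<^sub>F y in at_left (- x). (P (- x) u - \<epsilon>) * (- x - y) \<le> E (- x) u - E y u"
      using x assms by (intro E_left_diff_ge) auto
    then have "\<forall>\<^sub>F y in at_right x. (P (- x) u - \<epsilon>) * (- x - (- y)) \<le> E (- x) u - E (- y) u"
      unfolding at_left_minus[of "- x"] by (simp add: eventually_filtermap)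
    moreover have "\<forall>\<^sub>F y in at_right x. x < y" by (simp add: eventually_at_filter)
    ultimately show "\<forall>\<^sub>F y in at_right x. F (- y) u \<le> F (- x) u + (C * F (- x) u + \<epsilon>) * (y - x)"
    proof eventually_elim
      case (elim y)
      have "(- (C * F (- x) u) - \<epsilon>) * (y - x) \<le> (P (- x) u - \<epsilon>) * (y - x)"
        using P_bound[of "- x" u] x assms elim by (intro mult_right_mono) auto
      then show ?case using elim by (simp add: perturbed_def algebra_simps)
    qed
  qed (use assms C_pos in \<open>auto intro: F_nonneg\<close>)
  then show ?thesis by simp
qed

text \<open>Gronwall in both directions compares \<open>F\<close> at the two times. Replacing
  \<open>F s u\<close> by \<open>F t u\<close> costs a second exponential, hence the factor 2 in the
  exponent.\<close>

lemma E_lipschitz: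
  assumes "s \<in> {0..T}" "t \<in> {0..T}" "F t u \<le> M"
  shows "\<bar>E t u - E s u\<bar> \<le> C * exp (2 * C * T) * M * \<bar>t - s\<bar>"
proof -
  define x where "x = C * \<bar>t - s\<bar>"
  have x: "0 \<le> x" "x \<le> C * T" using assms C_pos by (auto simp: x_def)
  have "0 \<le> M" using F_nonneg[OF assms(2), of u] assms(3) by simp
  have st: "F s u \<le> exp x * F t u" "F t u \<le> exp x * F s u"
    using F_gronwall_forward[of s t u] F_gronwall_backward[of s t u] F_gronwall_forward[of t s u]
      F_gronwall_backward[of t s u] assms(1,2)
    by (auto simp: x_def abs_if split: if_splits)
  have ex: "exp x - 1 \<le> x * exp x"
    using mult_left_mono[OF exp_ge_add_one_self[of "- x"], of "exp x"] by (simp add: algebra_simps flip: exp_add)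
  have "F s u - F t u \<le> (exp x - 1) * F t u" using st by (simp add: algebra_simps)
  also have "\<dots> \<le> (x * exp x) * M" using ex assms F_nonneg x by (intro mult_mono) auto
  also have "\<dots> \<le> (x * exp (2 * C * T)) * M" using x \<open>0 \<le> M\<close> by (intro mult_right_mono mult_left_mono) auto
  finally have 1: "F s u - F t u \<le> x * exp (2 * C * T) * M" .
  have "F t u - F s u \<le> (exp x - 1) * F s u" using st by (simp add: algebra_simps)
  also have "\<dots> \<le> (x * exp x) * (exp x * M)"
    using ex F_nonneg[OF assms(1)] x st(1) order_trans[OF st(1) mult_left_mono[OF assms(3)]] by (intro mult_mono) auto
  also have "\<dots> = (x * exp (x + x)) * M" unfolding exp_add by simp
  also have "\<dots> \<le> (x * exp (2 * C * T)) * M" using x \<open>0 \<le> M\<close> by (intro mult_right_mono mult_left_mono) auto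
  finally have "F t u - F s u \<le> x * exp (2 * C * T) * M" .
  with 1 show ?thesis by (simp add: perturbed_def x_def algebra_simps)
qed

section \<open>A priori bounds for visco-energetic solutions\<close>

context
  fixes u \<mu>
  assumes VE: "VE_solution T E P \<mu> u"
begin

lemma VE_BV: "BV T u" using VE by (simp add: VE_solution_def)

lemma VE_power_integrable: "t \<le> T \<Longrightarrow> set_integrable lebesgue {0..t} (\<lambda>s. P s (u s))"
  using VE unfolding VE_solution_def by (auto intro: set_integrable_subset)

lemma VE_var_fun_le:
  assumes "t \<in> {0..T}"
  shows "E t (u t) + var_fun u t \<le> E 0 (u 0) + (LINT s:{0..t}|lebesgue. P s (u s))"
proof -
  have "Var u {0..t} \<le> aug_Var T (VE_cost E \<mu>) u 0 t" by (simp add: aug_Var_def)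
  then have "enn2ereal (ennreal (var_fun u t)) \<le> enn2ereal (aug_Var T (VE_cost E \<mu>) u 0 t)"
    using Var_eq_var_fun[OF VE_BV] assms by (simp add: less_eq_ennreal.rep_eq)
  then have "ereal (E t (u t)) + ereal (var_fun u t) \<le> ereal (E t (u t)) + enn2ereal (aug_Var T (VE_cost E \<mu>) u 0 t)"
    by (intro add_left_mono) (simp add: var_fun_nonneg)
  also have "\<dots> = ereal (E 0 (u 0) + (LINT s:{0..t}|lebesgue. P s (u s)))"
    using VE assms unfolding VE_solution_def by blast
  finally show ?thesis by simp
qed

text \<open>\<open>F\<close> along the curve may jump, so Gronwall is applied to the continuous
  majorant \<open>p\<close>. It dominates \<open>F\<close> because the variation absorbs the
  distance travelled from \<open>u 0\<close>, and its density \<open>f\<close> is at most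
  \<open>C * F\<close>.\<close>

lemma VE_energy_bound:
  assumes "t \<in> {0..T}"
  shows "F t (u t) \<le> exp (C * T) * F 0 (u 0)"
proof -
  define f where "f s = \<bar>P s (u s)\<bar>" for s
  define p where "p t = F 0 (u 0) + integral {0..t} f" for t
  have int: "f integrable_on {0..T}"
    unfolding f_def using set_integrable_abs[OF VE_power_integrable[of T]] set_lebesgue_integral_eq_integral(1) by blast
  have int': "f integrable_on {a..b}" if "0 \<le> a" "b \<le> T" for a b
    using integrable_on_subinterval[OF int, of a b] that by auto
  have diff: "p b - p a = integral {a..b} f" if "0 \<le> a" "a \<le> b" "b \<le> T" for a b
    using Henstock_Kurzweil_Integration.integral_combine[OF that(1,2) int'] that(3) by (simp add: p_def)
  have mono: "p a \<le> p b" if "0 \<le> a" "a \<le> b" "b \<le> T" for a b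
    using diff[OF that] integral_nonneg[OF int'[OF that(1,3)]] by (simp add: f_def)
  have F_le: "F x (u x) \<le> p x" if x: "x \<in> {0..T}" for x
  proof -
    have "(LINT s:{0..x}|lebesgue. P s (u s)) \<le> integral {0..x} f"
      using set_lebesgue_integral_eq_integral[OF VE_power_integrable[of x]] int'[of 0 x] x
      by (auto simp: f_def intro!: integral_le)
    moreover have "dist (u 0) (u x) \<le> var_fun u x"
      using dist_le_var_fun_diff[OF VE_BV, of 0 x] x var_fun_nonneg[of u 0] by auto
    moreover have "dist xo (u x) \<le> dist xo (u 0) + dist (u 0) (u x)" by (rule dist_triangle)
    ultimately show ?thesis using VE_var_fun_le[OF x] by (simp add: p_def perturbed_def)
  qed
  have p_nonneg: "0 \<le> p x" if "x \<in> {0..T}" for x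
    using F_nonneg[OF that, of "u x"] F_le[OF that] by simp
  have cont: "continuous_on {0..T} p"
    unfolding p_def by (intro continuous_intros indefinite_integral_continuous_1 int)
  then have p_tendsto: "(p \<longlongrightarrow> p x) (at x within A)" if "x \<in> {0..T}" "A \<subseteq> {0..T}" for x A
    using that by (auto simp: continuous_on_def intro: tendsto_within_subset)
  have "p t \<le> exp (C * (t - 0)) * p 0"
  proof (rule right_dini_gronwall)
    fix x c assume x: "0 < x" "x \<le> t" "c < p x"
    have "(p \<longlongrightarrow> p x) (at x within {0..x})"
      using x assms by (intro p_tendsto) auto
    then have "(p \<longlongrightarrow> p x) (at_left x)" using x by (simp add: at_within_Icc_at_left)
    then show "\<forall>\<^sub>F s in at_left x. c < p s" using x order_tendstoD(1) by blast
  next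
    fix x \<epsilon> :: real assume x: "0 \<le> x" "x < t" "\<epsilon> > 0"
    have "(p \<longlongrightarrow> p x) (at x within {x..T})"
      using x assms by (intro p_tendsto) auto
    then have "(p \<longlongrightarrow> p x) (at_right x)" using x assms by (simp add: at_within_Icc_at_right)
    \<comment> \<open>On \<open>[x, s]\<close> the density \<open>f\<close> is at most
      \<open>C * p s\<close>, which by continuity stays below \<open>C * p x + \<epsilon>\<close>
      for \<open>s\<close> near \<open>x\<close>.\<close>
    then have "((\<lambda>s. C * p s) \<longlongrightarrow> C * p x) (at_right x)" by (intro tendsto_intros)
    then have "\<forall>\<^sub>F s in at_right x. C * p s < C * p x + \<epsilon>" using x by (intro order_tendstoD(2)) auto
    moreover have "\<forall>\<^sub>F s in at_right x. s \<in> {x<..<t}" using x(2) by (rule eventually_at_right_real)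
    ultimately show "\<forall>\<^sub>F s in at_right x. p s \<le> p x + (C * p x + \<epsilon>) * (s - x)"
    proof eventually_elim
      case (elim s)
      have "f y \<le> C * p s" if "y \<in> {x..s}" for y
      proof -
        have y: "y \<in> {0..T}" "s \<le> T" using that x elim assms by auto
        have "f y \<le> C * F y (u y)" unfolding f_def by (rule P_bound[OF y(1)])
        also have "\<dots> \<le> C * p s" using F_le[OF y(1)] mono[of y s] y that C_pos by auto
        finally show ?thesis .
      qed
      then have "integral {x..s} f \<le> integral {x..s} (\<lambda>_. C * p s)"
        using x elim assms by (intro integral_le int') auto
      then have "p s - p x \<le> (s - x) * (C * p s)" using diff[of x s] x elim assms by (simp add: mult_ac)
      also have "\<dots> \<le> (s - x) * (C * p x + \<epsilon>)" using elim by (intro mult_left_mono) auto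
      finally show ?case by (simp add: mult.commute)
    qed
  qed (use assms C_pos p_nonneg in auto)
  also have "\<dots> \<le> exp (C * T) * p 0"
    using assms C_pos p_nonneg T_pos by (intro mult_right_mono) auto
  finally show ?thesis using F_le[OF assms] by (simp add: p_def)
qed

end

end

section \<open>Passage to the limit\<close>

text \<open>The two conclusions share a proof: at the exceptional times, convergence of the energies
  is deduced from the balance of the limit.\<close>

lemma (in rate_independent_system) energetic_limit:
  assumes E3: "cond_E3 T E P"
    and VE: "\<And>n. VE_solution T E P (\<mu> n) (v n)" and \<mu>: "\<mu> \<longlonglongrightarrow> 0"
    and conv: "\<And>t. t \<in> {0..T} \<Longrightarrow> (\<lambda>n. v n t) \<longlonglongrightarrow> u t"
    and F_le: "\<And>n t. t \<in> {0..T} \<Longrightarrow> F t (v n t) \<le> M"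
    and V: "\<And>n. Var (v n) {0..T} \<le> ennreal V"
    and init: "(\<lambda>n. E 0 (v n 0)) \<longlonglongrightarrow> E 0 (u 0)" and stable0: "d_stable E 0 (u 0)"
  shows "energetic_solution T E P u"
    and "\<And>t. t \<in> {0..T} \<Longrightarrow> (\<lambda>n. E t (v n t)) \<longlonglongrightarrow> E t (u t)"
proof -
  \<comment> \<open>\<open>L K\<close> is the Lipschitz constant in time at level \<open>K\<close>;
    \<open>B\<close> dominates both \<open>L M\<close> and the power along all curves
    involved.\<close>
  define L where "L K = C * exp (2 * C * T) * K" for K
  define B where "B = max (L M) (C * M)"
  have F_u: "F t (u t) \<le> M" if t: "t \<in> {0..T}" for t
  proof (rule ccontr)
    assume "\<not> F t (u t) \<le> M"
    then have "\<forall>\<^sub>F n in sequentially. M < F t (v n t)"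
      using t by (intro eventually_F_less[OF tendsto_const conv[OF t]]) auto
    then show False using F_le[OF t] by (auto simp: eventually_sequentially not_less[symmetric])
  qed
  have P_le: "\<bar>P t x\<bar> \<le> B" if "t \<in> {0..T}" "F t x \<le> M" for t x
  proof -
    have "\<bar>P t x\<bar> \<le> C * F t x" using that by (intro P_bound)
    also have "\<dots> \<le> C * M" using that C_pos by (intro mult_left_mono) auto
    finally show ?thesis by (simp add: B_def)
  qed
  have lsc: "\<forall>\<^sub>F n in sequentially. c < E t (v n t)" if "t \<in> {0..T}" "c < E t (u t)" for t c
    using that by (intro eventually_E_less[OF tendsto_const conv]) auto
  have Var_le: "Var u {0..T} \<le> ennreal V"
  proof (rule ccontr)
    assume "\<not> Var u {0..T} \<le> ennreal V"
    then have "\<forall>\<^sub>F n in sequentially. ennreal V < Var (v n) {0..T}"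
      by (intro less_Var_eventually[OF conv]) auto
    then show False using V by (auto simp: eventually_sequentially not_less[symmetric])
  qed
  have BV: "BV T u"
    unfolding BV_def using order.strict_trans1[OF Var_le] by (metis ennreal_less_top infinity_ennreal_def)
  have var_lsc: "\<forall>\<^sub>F n in sequentially. var_fun u t - \<delta> < var_fun (v n) t" if t: "t \<in> {0..T}" and "\<delta> > 0" for t \<delta>
  proof (cases "var_fun u t - \<delta> < 0")
    case True
    then show ?thesis by (intro always_eventually allI less_le_trans[OF True var_fun_nonneg])
  next
    case False
    then have "ennreal (var_fun u t - \<delta>) < Var u {0..t}"
      using Var_eq_var_fun[OF BV, of t] t \<open>\<delta> > 0\<close> by (simp add: ennreal_less_iff)
    then have "\<forall>\<^sub>F n in sequentially. ennreal (var_fun u t - \<delta>) < Var (v n) {0..t}"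
      using t by (intro less_Var_eventually[OF conv]) auto
    then show ?thesis
      by eventually_elim (use Var_eq_var_fun[OF VE_BV[OF VE]] t False in \<open>simp add: ennreal_less_iff\<close>)
  qed
  \<comment> \<open>Time 0 is kept even if it is a jump time, since stability and convergence of
    energies there are hypotheses.\<close>
  define S where "S = insert 0 ({0..T} - (\<Union>n. jump_set T (v n)))"
  have S: "S \<subseteq> {0..T}" "0 \<in> S" using T_pos by (auto simp: S_def)
  have "countable (\<Union>n. jump_set T (v n))" using VE_BV[OF VE] by (auto intro: countable_jump_set)
  then have S_co: "countable ({0..T} - S)" by (rule countable_subset[rotated]) (auto simp: S_def)

  have S_stable: "d_stable E t (u t) \<and> (\<lambda>n. E t (v n t)) \<longlonglongrightarrow> E t (u t)" if "t \<in> S" for t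
  proof (cases "t = 0")
    case True
    then show ?thesis using stable0 init by simp
  next
    case False
    then have t: "t \<in> {0..T}" "\<And>n. t \<notin> jump_set T (v n)" using that by (auto simp: S_def)
    let ?R = "\<lambda>x n. E t x + dist (v n t) x + \<mu> n / 2 * (dist (v n t) x)\<^sup>2"
    have le: "E t (v n t) \<le> ?R x n" for x n
      using VE[of n] t unfolding VE_solution_def by blast
    have R_lim: "?R x \<longlonglongrightarrow> E t x + dist (u t) x + 0 / 2 * (dist (u t) x)\<^sup>2" for x
      by (intro tendsto_intros conv[OF t(1)] \<mu>) simp
    \<comment> \<open>Lower semicontinuity gives one bound; testing the stability of
      \<open>v n\<close> with the competitor \<open>u t\<close> gives the other.\<close>
    have E_lim: "(\<lambda>n. E t (v n t)) \<longlonglongrightarrow> E t (u t)"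
    proof (rule order_tendstoI)
      fix c assume "c < E t (u t)" then show "\<forall>\<^sub>F n in sequentially. c < E t (v n t)" by (rule lsc[OF t(1)])
    next
      fix c assume "E t (u t) < c"
      then have "\<forall>\<^sub>F n in sequentially. ?R (u t) n < c" by (intro order_tendstoD(2)[OF R_lim]) simp
      then show "\<forall>\<^sub>F n in sequentially. E t (v n t) < c" by eventually_elim (rule le_less_trans[OF le])
    qed
    have "E t (u t) \<le> E t x + dist (u t) x" for x
      using LIMSEQ_le[OF E_lim R_lim] le by simp
    with E_lim show ?thesis by (simp add: d_stable_def)
  qed

  define p where "p s = P s (u s)" for s
  define e where "e t = E t (u t) + var_fun u t" for t
  define I where "I n t = (LINT s:{0..t}|lebesgue. P s (v n s))" for n t
  have p_le: "\<bar>p s\<bar> \<le> B" if "s \<in> {0..T}" for s unfolding p_def using that by (intro P_le F_u)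
  have I_le: "\<bar>I n t\<bar> \<le> B * t" if t: "t \<in> {0..T}" for n t
    unfolding I_def using t by (intro set_nn_integral_offset(3) VE_power_integrable[OF VE] P_le F_le) auto
  have limsup_P: "\<forall>\<^sub>F n in sequentially. P s (v n s) < p s + \<epsilon>" if "s \<in> S" "0 < \<epsilon>" for s \<epsilon>
  proof -
    have "s \<in> {0..T}" using that S by auto
    then have "limsup (\<lambda>n. ereal (P s (v n s))) \<le> ereal (p s)"
      using E3[unfolded cond_E3_def, rule_format, of "\<lambda>_. s" s "\<lambda>n. v n s" "u s"] conv S_stable[OF that(1)]
      by (simp add: p_def)
    then show ?thesis
      using that(2) unfolding Limsup_le_iff by (auto dest!: spec[of _ "ereal (p s + \<epsilon>)"])
  qed
  obtain G where G_meas: "G \<in> borel_measurable lebesgue"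
    and G: "AE s in lebesgue. s \<in> {0..T} \<longrightarrow> ennreal (B - p s) \<le> G s"
    and G_le_liminf: "\<And>t. t \<in> {0..T} \<Longrightarrow> (\<integral>\<^sup>+s\<in>{0..t}. G s \<partial>lebesgue) \<le> liminf (\<lambda>n. ennreal (B * t - I n t))"
    unfolding I_def
    by (rule Fatou_upper[of T S "\<lambda>n s. P s (v n s)" B p])
      (use T_pos S_co VE_power_integrable[OF VE] P_le F_le limsup_P in auto)

  \<comment> \<open>Stability at \<open>s\<close> is tested with \<open>u t\<close>; the variation
    increment pays for the distance and \<open>B\<close> for the change of time at the fixed state
    \<open>u t\<close>.\<close>
  have incr: "e s + B * s \<le> e t + B * t" if st: "s \<in> S" "t \<in> {0..T}" "s \<le> t" for s t
  proof -
    have s: "s \<in> {0..T}" using st S by auto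
    have "E s (u s) \<le> E s (u t) + dist (u s) (u t)" using S_stable[OF st(1)] by (simp add: d_stable_def)
    moreover have "\<bar>E t (u t) - E s (u t)\<bar> \<le> L M * \<bar>t - s\<bar>"
      unfolding L_def by (rule E_lipschitz[OF s st(2) F_u[OF st(2)]])
    moreover have "L M * \<bar>t - s\<bar> \<le> B * (t - s)" using st(3) by (auto simp: B_def intro: mult_right_mono)
    moreover have "dist (u s) (u t) \<le> var_fun u t - var_fun u s"
      using s st by (intro dist_le_var_fun_diff[OF BV]) auto
    ultimately show ?thesis by (simp add: e_def algebra_simps)
  qed
  have dini: "\<forall>\<^sub>F s in at_left t. s \<in> S \<longrightarrow> (p t - \<epsilon>) * (t - s) \<le> e t - e s" if t: "t \<in> S" "0 < t" "0 < \<epsilon>" for t \<epsilon>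
  proof -
    have tT: "t \<in> {0<..T}" using t S by auto
    show ?thesis
      using E_left_diff_ge[OF tT t(3), of "u t"] eventually_at_left_real[OF t(2)]
    proof (eventually_elim, intro impI)
      fix s assume s: "(P t (u t) - \<epsilon>) * (t - s) \<le> E t (u t) - E s (u t)" "s \<in> {0<..<t}" "s \<in> S"
      have "E s (u s) \<le> E s (u t) + dist (u s) (u t)" using S_stable[OF s(3)] by (simp add: d_stable_def)
      moreover have "dist (u s) (u t) \<le> var_fun u t - var_fun u s"
        using s tT by (intro dist_le_var_fun_diff[OF BV]) auto
      ultimately show "(p t - \<epsilon>) * (t - s) \<le> e t - e s" using s(1) by (simp add: e_def p_def)
    qed
  qed
  obtain Q where Q_meas: "Q \<in> borel_measurable lebesgue"
    and Q: "AE s in lebesgue. s \<in> {0..T} \<longrightarrow> ennreal (p s + B) \<le> Q s"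
    and Q_le: "\<And>t. t \<in> {0..T} \<Longrightarrow> (\<integral>\<^sup>+s\<in>{0..t}. Q s \<partial>lebesgue) \<le> ennreal (e t - e 0 + B * t)"
    by (rule Fatou_lower_dini[where e=e and B=B and p=p, OF less_imp_le[OF T_pos] S S_co])
      ((rule incr; assumption) | (rule dini; assumption) | blast)+

  have e0: "e 0 = E 0 (u 0)" by (simp add: e_def var_fun_def Var_singleton)
  \<comment> \<open>Limit of the energy estimate for \<open>v n\<close>: final energy, variation and
    initial energy each cost \<open>\<delta> / 3\<close>.\<close>
  have I_ge: "\<forall>\<^sub>F n in sequentially. e t - e 0 - \<delta> < I n t" if t: "t \<in> {0..T}" and "\<delta> > 0" for t \<delta>
  proof -
    have "\<forall>\<^sub>F n in sequentially. E t (u t) - \<delta> / 3 < E t (v n t)" using t \<open>\<delta> > 0\<close> by (intro lsc) auto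
    moreover have "\<forall>\<^sub>F n in sequentially. var_fun u t - \<delta> / 3 < var_fun (v n) t" using t \<open>\<delta> > 0\<close> by (intro var_lsc) auto
    moreover have "\<forall>\<^sub>F n in sequentially. E 0 (v n 0) < E 0 (u 0) + \<delta> / 3" using \<open>\<delta> > 0\<close> by (intro order_tendstoD(2)[OF init]) auto
    ultimately show ?thesis
    proof eventually_elim
      case (elim n)
      then show ?case using VE_var_fun_le[OF VE[of n] t] unfolding I_def e0 e_def[of t] by linarith
    qed
  qed
  have a_le: "\<bar>e t - e 0\<bar> \<le> B * t" if t: "t \<in> {0..T}" for t
  proof -
    have "e t - e 0 \<le> B * t"
    proof (rule field_le_epsilon)
      fix \<delta> :: real assume "\<delta> > 0"
      from I_ge[OF t this] obtain n where "e t - e 0 - \<delta> < I n t" by (auto simp: eventually_sequentially)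
      then show "e t - e 0 \<le> B * t + \<delta>" using I_le[OF t, of n] by linarith
    qed
    moreover have "e 0 \<le> e t + B * t" using incr[OF S(2) t] t by simp
    ultimately show ?thesis by simp
  qed
  have G_le: "(\<integral>\<^sup>+s\<in>{0..t}. G s \<partial>lebesgue) \<le> ennreal (B * t - (e t - e 0))" if t: "t \<in> {0..T}" for t
  proof -
    have "liminf (\<lambda>n. ennreal (B * t - I n t)) \<le> ennreal (B * t - (e t - e 0) + 1 / real (Suc k))" for k
    proof (rule Liminf_le[OF sequentially_bot])
      have "\<forall>\<^sub>F n in sequentially. e t - e 0 - 1 / real (Suc k) < I n t" by (intro I_ge t) simp
      then show "\<forall>\<^sub>F n in sequentially. ennreal (B * t - I n t) \<le> ennreal (B * t - (e t - e 0) + 1 / real (Suc k))"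
        by eventually_elim (intro ennreal_leI, simp)
    qed
    moreover have "(\<lambda>k. ennreal (B * t - (e t - e 0) + 1 / real (Suc k))) \<longlonglongrightarrow> ennreal (B * t - (e t - e 0) + 0)"
      by (intro tendsto_ennrealI tendsto_intros lim_1_over_n[THEN LIMSEQ_Suc])
    ultimately have "liminf (\<lambda>n. ennreal (B * t - I n t)) \<le> ennreal (B * t - (e t - e 0) + 0)"
      by (intro LIMSEQ_le_const[where a="liminf (\<lambda>n. ennreal (B * t - I n t))"]) auto
    with G_le_liminf[OF t] show ?thesis by simp
  qed
  have p_int: "set_integrable lebesgue {0..T} p"
    and p_eq: "\<And>t. t \<in> {0..T} \<Longrightarrow> (LINT s:{0..t}|lebesgue. p s) = e t - e 0"
    by (rule sandwiched_integral[where a="\<lambda>t. e t - e 0", OF _ Q_meas G_meas _ G p_le _ G_le a_le];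
        use T_pos Q Q_le in \<open>simp add: add.commute\<close>)+

  \<comment> \<open>The integral of \<open>p\<close> is now known, so the Fatou bound through
    \<open>G\<close> gives an upper limit of at most \<open>e t - e 0\<close> for
    \<open>I n t\<close>. With lower semicontinuity of the variation, this bounds the energies from
    above at every time.\<close>
  show E_conv: "(\<lambda>n. E t (v n t)) \<longlonglongrightarrow> E t (u t)" if t: "t \<in> {0..T}" for t
  proof (rule order_tendstoI)
    fix c assume "c < E t (u t)" then show "\<forall>\<^sub>F n in sequentially. c < E t (v n t)" by (rule lsc[OF t])
  next
    fix c assume c: "E t (u t) < c"
    define \<delta> where "\<delta> = (c - E t (u t)) / 3"
    have "\<delta> > 0" using c by (simp add: \<delta>_def)
    have "set_integrable lebesgue {0..t} p" using t by (intro set_integrable_subset[OF p_int]) auto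
    from set_nn_integral_offset(2)[OF this, of B]
    have "ennreal (B * t - (e t - e 0)) = (\<integral>\<^sup>+s\<in>{0..t}. ennreal (B - p s) \<partial>lebesgue)"
      using p_le p_eq[OF t] t by simp
    also have "\<dots> \<le> (\<integral>\<^sup>+s\<in>{0..t}. G s \<partial>lebesgue)"
      using G t by (intro nn_integral_mono_AE) (auto elim!: eventually_mono split: split_indicator)
    also have "\<dots> \<le> liminf (\<lambda>n. ennreal (B * t - I n t))" by (rule G_le_liminf[OF t])
    finally have lim: "ennreal (B * t - (e t - e 0)) \<le> liminf (\<lambda>n. ennreal (B * t - I n t))" .
    have "\<forall>\<^sub>F n in sequentially. I n t < e t - e 0 + \<delta>"
    \<comment> \<open>Strict comparison in \<open>ennreal\<close> needs a positive right-hand side;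
      otherwise \<open>I n t \<le> B * t\<close> already suffices.\<close>
    proof (cases "B * t - (e t - e 0) \<le> 0")
      case True
      have "I n t < e t - e 0 + \<delta>" for n using I_le[OF t, of n] True \<open>\<delta> > 0\<close> by linarith
      then show ?thesis by simp
    next
      case False
      then have "ennreal (B * t - (e t - e 0) - \<delta>) < ennreal (B * t - (e t - e 0))"
        using \<open>\<delta> > 0\<close> by (intro ennreal_lessI) auto
      with lim have "\<forall>\<^sub>F n in sequentially. ennreal (B * t - (e t - e 0) - \<delta>) < ennreal (B * t - I n t)"
        unfolding le_Liminf_iff by blast
      then show ?thesis
      proof eventually_elim
        case (elim n)
        then have "\<not> B * t - I n t \<le> B * t - (e t - e 0) - \<delta>" using ennreal_leI leD by blast
        then show ?case by simp
      qed
    qed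
    moreover have "\<forall>\<^sub>F n in sequentially. var_fun u t - \<delta> < var_fun (v n) t" using t \<open>\<delta> > 0\<close> by (intro var_lsc) auto
    moreover have "\<forall>\<^sub>F n in sequentially. E 0 (v n 0) < E 0 (u 0) + \<delta>" using \<open>\<delta> > 0\<close> by (intro order_tendstoD(2)[OF init]) auto
    ultimately show "\<forall>\<^sub>F n in sequentially. E t (v n t) < c"
    proof eventually_elim
      case (elim n)
      have "3 * \<delta> = c - E t (u t)" by (simp add: \<delta>_def)
      then show ?case using elim VE_var_fun_le[OF VE[of n] t] unfolding I_def e0 e_def[of t] by linarith
    qed
  qed

  have e_diff: "e t - e s \<le> B * (t - s)" if st: "0 \<le> s" "s \<le> t" "t \<le> T" for s t
  proof -
    have p_hk: "p integrable_on {a..b}" if "0 \<le> a" "b \<le> T" for a b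
      by (rule integrable_on_subinterval[OF set_lebesgue_integral_eq_integral(1)[OF p_int]]) (use that in auto)
    have eq: "integral {0..x} p = e x - e 0" if "x \<in> {0..T}" for x
      using p_eq[OF that] set_lebesgue_integral_eq_integral(2)[OF set_integrable_subset[OF p_int, of "{0..x}"]] that by simp
    have "integral {s..t} p \<le> integral {s..t} (\<lambda>_. B)"
      using st p_le by (intro integral_le p_hk) (auto simp: abs_le_iff)
    moreover have "integral {0..s} p + integral {s..t} p = integral {0..t} p"
      using st by (intro Henstock_Kurzweil_Integration.integral_combine p_hk) auto
    ultimately show ?thesis using eq[of s] eq[of t] st by (simp add: mult.commute)
  qed
  have stable: "d_stable E t (u t)" if t: "t \<in> {0..T}" for t
  proof (cases "t = 0")
    case True
    then show ?thesis using stable0 by simp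
  next
    case False
    \<comment> \<open>Stability at a nearby earlier \<open>s\<close> in \<open>S\<close> is added to
      \<open>e_diff\<close>; the variation increment contained in \<open>e\<close> pays for the
      distance from \<open>u s\<close> to \<open>u t\<close>.\<close>
    have "E t (u t) \<le> E t x + dist (u t) x" for x
    proof (rule field_le_epsilon)
      fix \<epsilon> :: real assume "\<epsilon> > 0"
      \<comment> \<open>The competitor \<open>x\<close> has its own energy level, hence the rate
        \<open>L (F t x)\<close>; \<open>K\<close> dominates its sum with \<open>B\<close> and is
        positive.\<close>
      define K where "K = \<bar>L (F t x)\<bar> + \<bar>B\<bar> + 1"
      have "K > 0" by (simp add: K_def)
      have lt: "max 0 (t - \<epsilon> / K) < t" using t False \<open>\<epsilon> > 0\<close> \<open>K > 0\<close> by auto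
      \<comment> \<open>An open interval is uncountable, so it meets the co-countable set
        \<open>S\<close>.\<close>
      have "\<not> {max 0 (t - \<epsilon> / K)<..<t} \<subseteq> {0..T} - S"
        using uncountable_open_interval[of "max 0 (t - \<epsilon> / K)" t] lt countable_subset[OF _ S_co] by auto
      then obtain s where s: "s \<in> S" "s \<in> {0..T}" "s < t" "t - s < \<epsilon> / K"
        using t by (auto simp: subset_iff)
      have "\<bar>E t x - E s x\<bar> \<le> L (F t x) * \<bar>t - s\<bar>"
        unfolding L_def by (rule E_lipschitz[OF s(2) t order_refl])
      moreover have "L (F t x) * \<bar>t - s\<bar> + B * (t - s) \<le> \<epsilon>"
      proof -
        have "L (F t x) * \<bar>t - s\<bar> + B * (t - s) = (L (F t x) + B) * (t - s)" using s by (simp add: algebra_simps)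
        also have "\<dots> \<le> K * (t - s)" using s by (intro mult_right_mono) (auto simp: K_def)
        also have "\<dots> \<le> \<epsilon>" using s(4) \<open>K > 0\<close> by (simp add: pos_less_divide_eq mult.commute)
        finally show ?thesis .
      qed
      moreover have "E s (u s) \<le> E s x + dist (u s) x" using S_stable[OF s(1)] by (simp add: d_stable_def)
      moreover have "dist (u s) x \<le> dist (u s) (u t) + dist (u t) x" by (rule dist_triangle)
      moreover have "dist (u s) (u t) \<le> var_fun u t - var_fun u s"
        using s t by (intro dist_le_var_fun_diff[OF BV]) auto
      moreover have "e t - e s \<le> B * (t - s)" using s t by (intro e_diff) auto
      ultimately show "E t (u t) \<le> E t x + dist (u t) x + \<epsilon>" unfolding e_def by linarith
    qed
    then show ?thesis by (simp add: d_stable_def)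
  qed
  show "energetic_solution T E P u"
    unfolding energetic_solution_def
  proof (intro conjI ballI BV stable)
    show "set_integrable lebesgue {0..T} (\<lambda>s. P s (u s))" using p_int by (simp add: p_def[abs_def])
    fix t assume t: "t \<in> {0..T}"
    show "ereal (E t (u t)) + enn2ereal (Var u {0..t}) = ereal (E 0 (u 0) + (LINT s:{0..t}|lebesgue. P s (u s)))"
      using p_eq[OF t, unfolded e0 e_def[of t]] Var_eq_var_fun[OF BV, of t] t
      by (simp add: p_def var_fun_nonneg)
  qed
qed

section \<open>Compactness and conclusion\<close>

text \<open>The uniform energy bound confines all values to the projection of one compact sublevel
  and bounds the variations, so Helly's theorem applies.\<close>

lemma (in rate_independent_system) convergent_subsequence:
  fixes v :: "nat \<Rightarrow> real \<Rightarrow> 'a"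
  assumes VE: "\<And>n. VE_solution T E P (\<mu> n) (v n)"
    and M: "\<And>n. exp (C * T) * F 0 (v n 0) \<le> M"
  obtains r u V where "strict_mono r" "\<And>t. t \<in> {0..T} \<Longrightarrow> (\<lambda>n. v (r n) t) \<longlonglongrightarrow> u t"
    "\<And>n. Var (v n) {0..T} \<le> ennreal V"
proof -
  have F_le: "F t (v n t) \<le> M" if "t \<in> {0..T}" for n t
    using VE_energy_bound[OF VE that] M by (rule order_trans)
  define K where "K = snd ` perturbed_sublevel T E xo M"
  have "compact K" unfolding K_def
    using E1 by (intro compact_continuous_image continuous_intros) (simp add: cond_E1_def)
  have v_K: "v n t \<in> K" if "t \<in> {0..T}" for n t
    unfolding K_def using F_le[OF that] that by (intro image_eqI[of _ _ "(t, v n t)"]) (auto simp: perturbed_sublevel_def)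
  obtain D where D: "\<And>x. x \<in> K \<Longrightarrow> dist xo x \<le> D"
    using compact_imp_bounded[OF \<open>compact K\<close>] unfolding bounded_any_center[of K xo] by blast
  \<comment> \<open>The summands bound the initial energy, the integral of the power, and minus the
    final energy, the last because \<open>F\<close> is nonnegative.\<close>
  define V where "V = M + C * M * T + D"
  have V_le: "Var (v n) {0..T} \<le> ennreal V" for n
  proof -
    have T: "T \<in> {0..T}" "0 \<in> {0..T}" using T_pos by auto
    have "\<bar>LINT s:{0..T}|lebesgue. P s (v n s)\<bar> \<le> C * M * T"
    proof (intro set_nn_integral_offset(3) VE_power_integrable[OF VE])
      fix s assume s: "s \<in> {0..T}"
      have "\<bar>P s (v n s)\<bar> \<le> C * F s (v n s)" by (rule P_bound[OF s])
      also have "\<dots> \<le> C * M" using F_le[OF s] C_pos by (intro mult_left_mono) auto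
      finally show "\<bar>P s (v n s)\<bar> \<le> C * M" .
    qed (use T_pos in auto)
    moreover have "E 0 (v n 0) \<le> M" using F_le[OF T(2), of n] zero_le_dist[of xo "v n 0"] unfolding perturbed_def by linarith
    moreover have "- D \<le> E T (v n T)"
      using F_nonneg[OF T(1), of "v n T"] D[OF v_K[OF T(1), of n]] unfolding perturbed_def by linarith
    ultimately have "var_fun (v n) T \<le> V"
      using VE_var_fun_le[OF VE[of n] T(1)] unfolding V_def by linarith
    then show ?thesis using Var_eq_var_fun[OF VE_BV[OF VE]] by (simp add: ennreal_leI)
  qed
  obtain r u where "strict_mono r" "\<And>t. t \<in> {0..T} \<Longrightarrow> (\<lambda>n. v (r n) t) \<longlonglongrightarrow> u t"
    by (rule Helly_selection_metric[where u=v and T=T and K=K and V=V]) (use \<open>compact K\<close> v_K V_le in blast)+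
  then show ?thesis using that V_le by blast
qed

theorem theorem1:
  fixes T :: real
    and E P :: "real \<Rightarrow> 'a::complete_space \<Rightarrow> real"
    and xo u0 :: 'a
    and u0n :: "nat \<Rightarrow> 'a"
    and \<mu> :: "nat \<Rightarrow> real"
    and un :: "nat \<Rightarrow> real \<Rightarrow> 'a"
  assumes "T > 0"
    and "cond_E1 T E xo"
    and "cond_E2 T E P xo"
    and "cond_E3 T E P"
    and "u0n \<longlonglongrightarrow> u0"
    and "(\<lambda>n. E 0 (u0n n)) \<longlonglongrightarrow> E 0 u0"
    and "d_stable E 0 u0"
    and "\<And>n. \<mu> n > 0"
    and "\<mu> \<longlonglongrightarrow> 0"
    and "\<And>n. VE_solution T E P (\<mu> n) (un n)"
    and "\<And>n. un n 0 = u0n n"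
  shows "\<exists>(r :: nat \<Rightarrow> nat) u.
           strict_mono r \<and> BV T u \<and> u 0 = u0 \<and>
           (\<forall>t \<in> {0..T}. (\<lambda>k. un (r k) t) \<longlonglongrightarrow> u t \<and>
                          (\<lambda>k. E t (un (r k) t)) \<longlonglongrightarrow> E t (u t)) \<and>
           energetic_solution T E P u"
proof -
  obtain C where "rate_independent_system T E P xo C"
    using assms(1-3) unfolding cond_E2_def rate_independent_system_def by blast
  then interpret rate_independent_system T E P xo C .
  \<comment> \<open>Convergence of the initial data and of their energies makes the energy bound
    uniform in \<open>n\<close>.\<close>
  have "(\<lambda>n. exp (C * T) * F 0 (un n 0)) \<longlonglongrightarrow> exp (C * T) * F 0 u0"
    unfolding perturbed_def assms(11) by (intro tendsto_intros assms(5,6))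
  then have "Bseq (\<lambda>n. exp (C * T) * F 0 (un n 0))"
    by (intro convergent_imp_Bseq convergentI)
  then obtain M where M: "\<And>n. exp (C * T) * F 0 (un n 0) \<le> M"
    unfolding Bseq_def by (auto simp: abs_le_iff)
  obtain r u V where r: "strict_mono r" and u: "\<And>t. t \<in> {0..T} \<Longrightarrow> (\<lambda>n. un (r n) t) \<longlonglongrightarrow> u t"
    and V: "\<And>n. Var (un n) {0..T} \<le> ennreal V"
    by (rule convergent_subsequence[where v=un, OF assms(10) M]) blast
  have "(\<lambda>n. un (r n) 0) \<longlonglongrightarrow> u0"
    using LIMSEQ_subseq_LIMSEQ[OF assms(5) r] by (simp add: assms(11) o_def)
  then have u0: "u 0 = u0" using LIMSEQ_unique[OF u[of 0]] \<open>T > 0\<close> by simp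
  have E0: "(\<lambda>n. E 0 (un (r n) 0)) \<longlonglongrightarrow> E 0 (u 0)"
    using LIMSEQ_subseq_LIMSEQ[OF assms(6) r] by (simp add: assms(11) o_def u0)
  have \<mu>: "(\<lambda>n. \<mu> (r n)) \<longlonglongrightarrow> 0"
    using LIMSEQ_subseq_LIMSEQ[OF assms(9) r] by (simp add: o_def)
  have F_le: "F t (un (r n) t) \<le> M" if "t \<in> {0..T}" for n t
    using VE_energy_bound[OF assms(10) that] M by (rule order_trans)
  have sol: "energetic_solution T E P u"
    by (rule energetic_limit(1)[OF assms(4,10) \<mu> u F_le V E0]) (use assms(7) u0 in auto)
  have "(\<lambda>n. E t (un (r n) t)) \<longlonglongrightarrow> E t (u t)" if "t \<in> {0..T}" for t
    by (rule energetic_limit(2)[OF assms(4,10) \<mu> u F_le V E0]) (use assms(7) u0 that in auto)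
  moreover have "BV T u" using sol by (simp add: energetic_solution_def)
  ultimately show ?thesis using r u u0 sol by blast
qed

end
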